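(* Let $d\geq 3$. For every finite or countably infinite partially ordered set $(Q,\leq_Q)$ there is a map $\varphi$ assigning to each $x\in Q$ a finite graph $G_x$ such that, for every $x\in Q$, $K_d\to L(G_x)$, $L(G_x)\to K_{d+1}$ and $K_{d+1}\not\to L(G_x)$, and such that for all $x,y\in Q$ we have $x\leq_Q y$ if and only if $L(G_x)\to L(G_y)$. In other words, the homomorphism order of line graphs restricted to the interval $[K_d,K_{d+1})_{\mathcal L}$ is universal.
   Context: Graphs are finite, simple and undirected. A homomorphism $f:G\to H$ is a map $V_G\to V_H$ such that $\{u,v\}\in E_G$ implies $\{f(u),f(v)\}\in E_H$; we write $G\to H$ if one exists. The homomorphism order is the partial order on the homomorphism-equivalence classes (equivalently on graph cores) given by $G\leq H$ iff $G\to H$; $G<H$ means $G\to H$ and $H\not\to G$. The line graph $L(G)$ has vertex set $E_G$, two distinct edges adjacent iff they share an endpoint. $[K_d,K_{d+1})_{\mathcal L}$ denotes the class of line graphs $L(G)$ with $K_d\leq L(G)<K_{d+1}$. A partial order is universal (for countable partial orders) if every finite or countable partial order embeds into it as a suborder. *)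

theory Defs
  imports Main "HOL-Library.Countable_Set"
begin

record 'a graph =
  verts :: "'a set"
  edges :: "'a set set"

definition finite_graph :: "'a graph \<Rightarrow> bool" where
  "finite_graph G \<longleftrightarrow>
     finite (verts G) \<and> (\<forall>e \<in> edges G. e \<subseteq> verts G \<and> card e = 2)"

definition graph_hom :: "'a graph \<Rightarrow> 'b graph \<Rightarrow> ('a \<Rightarrow> 'b) \<Rightarrow> bool" where
  "graph_hom G H f \<longleftrightarrow>
     f ` verts G \<subseteq> verts H \<and>
     (\<forall>u v. {u, v} \<in> edges G \<longrightarrow> {f u, f v} \<in> edges H)"

definition hom_to :: "'a graph \<Rightarrow> 'b graph \<Rightarrow> bool" (infix "\<lesssim>\<^sub>h" 50) where
  "G \<lesssim>\<^sub>h H \<longleftrightarrow> (\<exists>f. graph_hom G H f)"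

definition complete_graph :: "nat \<Rightarrow> nat graph" where
  "complete_graph n =
     \<lparr>verts = {..<n}, edges = {{u, v} | u v. u < n \<and> v < n \<and> u \<noteq> v}\<rparr>"

definition line_graph :: "'a graph \<Rightarrow> 'a set graph" where
  "line_graph G =
     \<lparr>verts = edges G,
      edges = {{e, e'} | e e'. e \<in> edges G \<and> e' \<in> edges G \<and> e \<noteq> e' \<and> e \<inter> e' \<noteq> {}}\<rparr>"

lemma finite_graph_complete_graph: "finite_graph (complete_graph n)"
  by (auto simp: finite_graph_def complete_graph_def)

lemma finite_graph_line_graph:
  assumes "finite_graph G"
  shows "finite_graph (line_graph G)"
proof -
  have "edges G \<subseteq> Pow (verts G)" and "finite (verts G)"
    using assms by (auto simp: finite_graph_def)
  then have "finite (edges G)"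
    by (meson finite_Pow_iff finite_subset)
  then show ?thesis
    unfolding finite_graph_def line_graph_def by (fastforce simp: card_2_iff)
qed

lemma hom_to_refl: "G \<lesssim>\<^sub>h G"
  unfolding hom_to_def by (rule exI[of _ id]) (auto simp: graph_hom_def)

lemma hom_to_trans: "G \<lesssim>\<^sub>h H \<Longrightarrow> H \<lesssim>\<^sub>h K \<Longrightarrow> G \<lesssim>\<^sub>h K"
proof -
  assume "G \<lesssim>\<^sub>h H" "H \<lesssim>\<^sub>h K"
  then obtain f g where "graph_hom G H f" "graph_hom H K g"
    by (auto simp: hom_to_def)
  then have "graph_hom G K (g \<circ> f)"
    unfolding graph_hom_def by (simp add: image_subset_iff)
  then show ?thesis by (auto simp: hom_to_def)
qed

end

theory Submission
  imports Defs "HOL-Computational_Algebra.Primes"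
begin

text \<open>
  The gadget is \<open>K\<^bsub>d,d\<^esub>\<close> with one edge \<open>ab\<close> removed and a dangling edge attached at each of \<open>a\<close>
  and \<open>b\<close>. A homomorphism from its line graph to the line graph of a triangle-free graph of maximum
  degree at most \<open>d\<close> sends stars to stars. Either all stars are sent to the same star, and then a
  Latin square argument shows that the two dangling edges have the same image, or the gadget is
  mapped isomorphically onto a copy of itself.

  A gadget whose dangling edges share an end cannot collapse, since adjacent edges have distinct
  images. Such loops serve as rigid anchors; three of them, attached to two kinds of vertices, and one
  further gadget make up a unit with a distinguishable beginning and end. In a ring of \<open>m\<close> units the
  only possible move is to the next unit, so the line graph of the ring of length \<open>m\<close> maps to that
  of the ring of length \<open>n\<close> iff \<open>n dvd m\<close>. Finite sets of positive integers, ordered by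
  ``every element of \<open>A\<close> is a multiple of some element of \<open>B\<close>'', contain every countable partial order,
  and are represented by disjoint unions of rings.
\<close>

section \<open>Line graphs and relations preserved by their homomorphisms\<close>

definition edge_adj :: "'a set set \<Rightarrow> 'a set \<Rightarrow> 'a set \<Rightarrow> bool" where
  "edge_adj E e e' \<longleftrightarrow> e \<in> E \<and> e' \<in> E \<and> e \<noteq> e' \<and> e \<inter> e' \<noteq> {}"

lemma edges_line_graph_iff:
  "{e, e'} \<in> edges (line_graph G) \<longleftrightarrow> edge_adj (edges G) e e'"
  by (auto simp: line_graph_def edge_adj_def doubleton_eq_iff)

lemma verts_line_graph: "verts (line_graph G) = edges G"
  by (simp add: line_graph_def)

lemma line_graph_hom_iff:
  "line_graph G \<lesssim>\<^sub>h line_graph H \<longleftrightarrow>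
    (\<exists>f. (\<forall>e \<in> edges G. f e \<in> edges H) \<and>
         (\<forall>e e'. edge_adj (edges G) e e' \<longrightarrow> edge_adj (edges H) (f e) (f e')))"
  by (auto simp: hom_to_def graph_hom_def edges_line_graph_iff verts_line_graph image_subset_iff)

lemma edges_complete_graph_iff:
  "{u, v} \<in> edges (complete_graph n) \<longleftrightarrow> u < n \<and> v < n \<and> u \<noteq> v"
  by (auto simp: complete_graph_def doubleton_eq_iff)

definition map_graph :: "('a \<Rightarrow> 'b) \<Rightarrow> 'a graph \<Rightarrow> 'b graph" where
  "map_graph f G = \<lparr>verts = f ` verts G, edges = (`) f ` edges G\<rparr>"

lemma finite_map_graph:
  assumes "inj f" "finite_graph G"
  shows "finite_graph (map_graph f G)"
  using assms by (auto simp: finite_graph_def map_graph_def card_image inj_on_subset)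

lemma edge_adj_image:
  assumes "inj f" "edge_adj E e e'"
  shows "edge_adj ((`) f ` E) (f ` e) (f ` e')"
  using assms by (auto simp: edge_adj_def inj_image_eq_iff)

lemma line_graph_to_map_graph:
  assumes "inj f"
  shows "line_graph G \<lesssim>\<^sub>h line_graph (map_graph f G)"
  unfolding line_graph_hom_iff
  by (rule exI[of _ "(`) f"]) (auto simp: map_graph_def intro: edge_adj_image[OF assms])

lemma map_graph_to_line_graph:
  assumes "inj f"
  shows "line_graph (map_graph f G) \<lesssim>\<^sub>h line_graph G"
proof -
  have vimg: "f -` f ` e = e" for e
    using assms by (simp add: inj_vimage_image_eq)
  have "edge_adj (edges G) (f -` e) (f -` e')"
    if "edge_adj (edges (map_graph f G)) e e'" for e e'
    using that assms
    by (auto simp: edge_adj_def map_graph_def vimg inj_image_eq_iff simp flip: image_Int)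
  then show ?thesis
    unfolding line_graph_hom_iff
    by (intro exI[of _ "vimage f"]) (auto simp: map_graph_def vimg)
qed

text \<open>In the line graph of a triangle-free graph such a triple consists of three edges at one
  vertex.\<close>

definition clique3 :: "('a \<Rightarrow> 'a \<Rightarrow> bool) \<Rightarrow> 'a \<Rightarrow> 'a \<Rightarrow> 'a \<Rightarrow> bool" where
  "clique3 r x y z \<longleftrightarrow> r x y \<and> r y z \<and> r x z"

definition corner :: "(nat \<Rightarrow> nat \<Rightarrow> 'a) \<Rightarrow> 'a \<Rightarrow> nat \<Rightarrow> nat \<Rightarrow> 'a" where
  "corner M x i j = (if i = 0 \<and> j = 0 then x else M i j)"

text \<open>\<open>linked d r\<close> says that \<open>x\<close> and \<open>y\<close> are the images of the dangling edges under a homomorphism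
  from the line graph of the gadget to the graph \<open>r\<close>: \<open>M i j\<close> is the image of the edge \<open>a\<^sub>i b\<^sub>j\<close>,
  and the dangling edge takes the place of the missing entry \<open>M 0 0\<close> in row 0 and in column 0.
  This relation and those built from it below are preserved by homomorphisms because they are
  defined by existential conditions.\<close>

definition linked :: "nat \<Rightarrow> ('a \<Rightarrow> 'a \<Rightarrow> bool) \<Rightarrow> 'a \<Rightarrow> 'a \<Rightarrow> bool" where
  "linked d r x y \<longleftrightarrow> (\<exists>M.
     (\<forall>i<d. \<forall>j<d. \<forall>k<d. j \<noteq> k \<longrightarrow> r (corner M x i j) (corner M x i k)) \<and>
     (\<forall>j<d. \<forall>i<d. \<forall>k<d. i \<noteq> k \<longrightarrow> r (corner M y i j) (corner M y k j)))"

text \<open>\<open>l\<close> and \<open>l'\<close> play the dangling edges of a loop and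
  \<open>s\<close> the third edge at its port. Being adjacent, \<open>l\<close> and
  \<open>l'\<close> are distinct when \<open>r\<close> is irreflexive, so the gadget between them
  cannot collapse.\<close>

definition anchor0 :: "nat \<Rightarrow> ('a \<Rightarrow> 'a \<Rightarrow> bool) \<Rightarrow> 'a \<Rightarrow> bool" where
  "anchor0 d r s \<longleftrightarrow> (\<exists>l l'. linked d r l l' \<and> clique3 r l l' s)"

definition anchor1 :: "nat \<Rightarrow> ('a \<Rightarrow> 'a \<Rightarrow> bool) \<Rightarrow> 'a \<Rightarrow> bool" where
  "anchor1 d r t \<longleftrightarrow> (\<exists>s s'. anchor0 d r s \<and> anchor0 d r s' \<and> clique3 r s s' t)"

text \<open>Models the passage from the left dangling edge of \<open>GC\<close> to that of the next
  unit: through the gadget to \<open>a\<close>, across \<open>V0\<close> to the edge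
  \<open>b\<close> from \<open>V0\<close> to \<open>V1\<close>, across \<open>V1\<close> to
  \<open>x'\<close>. The marked edges \<open>s\<close> and \<open>t\<close> tell \<open>V0\<close>
  from \<open>V1\<close> and so give the ring a direction.\<close>

definition step :: "nat \<Rightarrow> ('a \<Rightarrow> 'a \<Rightarrow> bool) \<Rightarrow> 'a \<Rightarrow> 'a \<Rightarrow> bool" where
  "step d r x x' \<longleftrightarrow> (\<exists>a b s t. linked d r x a \<and> anchor0 d r s \<and> clique3 r a b s \<and>
     anchor1 d r t \<and> clique3 r b x' t)"

context
  fixes r :: "'a \<Rightarrow> 'a \<Rightarrow> bool" and r' :: "'b \<Rightarrow> 'b \<Rightarrow> bool" and f :: "'a \<Rightarrow> 'b"
  assumes hom: "\<And>x y. r x y \<Longrightarrow> r' (f x) (f y)"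
begin

lemma clique3_hom: "clique3 r x y z \<Longrightarrow> clique3 r' (f x) (f y) (f z)"
  by (auto simp: clique3_def hom)

lemma linked_hom:
  assumes "linked d r x y" shows "linked d r' (f x) (f y)"
proof -
  have *: "corner (\<lambda>i j. f (M i j)) (f z) i j = f (corner M z i j)" for M z i j
    by (simp add: corner_def)
  obtain M where "\<forall>i<d. \<forall>j<d. \<forall>k<d. j \<noteq> k \<longrightarrow> r (corner M x i j) (corner M x i k)"
    "\<forall>j<d. \<forall>i<d. \<forall>k<d. i \<noteq> k \<longrightarrow> r (corner M y i j) (corner M y k j)"
    using assms unfolding linked_def by blast
  then show ?thesis
    unfolding linked_def by (intro exI[of _ "\<lambda>i j. f (M i j)"]) (simp add: * hom)
qed

lemma anchor0_hom: "anchor0 d r s \<Longrightarrow> anchor0 d r' (f s)"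
  unfolding anchor0_def using linked_hom clique3_hom by blast

lemma anchor1_hom: "anchor1 d r t \<Longrightarrow> anchor1 d r' (f t)"
  unfolding anchor1_def using anchor0_hom clique3_hom by blast

lemma step_hom: "step d r x y \<Longrightarrow> step d r' (f x) (f y)"
  unfolding step_def using linked_hom anchor0_hom anchor1_hom clique3_hom by meson

end

section \<open>Images of the gadget\<close>

locale triangle_free_graph =
  fixes E :: "'a set set" and d :: nat
  assumes d_ge_3: "d \<ge> 3"
    and card_edge: "e \<in> E \<Longrightarrow> card e = 2"
    and no_triangle: "{x, y} \<in> E \<Longrightarrow> {y, z} \<in> E \<Longrightarrow> {x, z} \<in> E \<Longrightarrow> False"
    and finite_star: "finite {e \<in> E. v \<in> e}"
    and card_star: "card {e \<in> E. v \<in> e} \<le> d"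
begin

lemma edge_other:
  assumes "e \<in> E" "v \<in> e"
  obtains x where "e = {v, x}" "x \<noteq> v"
  using card_edge[OF assms(1)] assms(2) by (auto simp: card_2_iff doubleton_eq_iff)

lemma edge_eq:
  assumes "e \<in> E" "v \<in> e" "x \<in> e" "v \<noteq> x"
  shows "e = {v, x}"
  using edge_other[OF assms(1,2)] assms(3,4) by auto

lemma common_end_unique:
  assumes "edge_adj E e e'" "v \<in> e" "v \<in> e'" "x \<in> e" "x \<in> e'"
  shows "v = x"
  using assms edge_eq[of e v x] edge_eq[of e' v x] by (auto simp: edge_adj_def)

text \<open>Otherwise \<open>e3\<close> would join the other ends of \<open>e1\<close> and
  \<open>e2\<close> and close a triangle of the graph.\<close>

lemma triangle_common:
  assumes "edge_adj E e1 e2" "edge_adj E e2 e3" "edge_adj E e1 e3" "v \<in> e1" "v \<in> e2"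
  shows "v \<in> e3"
proof (rule ccontr)
  assume v: "v \<notin> e3"
  have E: "e1 \<in> E" "e2 \<in> E" "e3 \<in> E" using assms by (auto simp: edge_adj_def)
  obtain x where x: "e1 = {v, x}" using edge_other E assms(4) by metis
  obtain y where y: "e2 = {v, y}" using edge_other E assms(5) by metis
  have "x \<noteq> y" "x \<in> e3" "y \<in> e3"
    using assms v x y by (auto simp: edge_adj_def)
  then have "e3 = {x, y}" using edge_eq E by metis
  then show False using no_triangle[of x v y] E x y by (simp add: insert_commute)
qed

lemma clique_star:
  fixes F :: "nat \<Rightarrow> 'a set"
  assumes "n \<ge> 3" and cl: "\<And>j k. j < n \<Longrightarrow> k < n \<Longrightarrow> j \<noteq> k \<Longrightarrow> edge_adj E (F j) (F k)"
  obtains v where "\<And>j. j < n \<Longrightarrow> v \<in> F j"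
proof -
  have "edge_adj E (F 0) (F 1)" using cl assms(1) by simp
  then obtain v where v: "v \<in> F 0" "v \<in> F 1" by (auto simp: edge_adj_def)
  have "v \<in> F j" if "j < n" for j
  proof (cases "j = 0 \<or> j = 1")
    case False
    then show ?thesis
      using triangle_common[of "F 0" "F 1" "F j" v] cl[of 0 1] cl[of 0 j] cl[of 1 j] v that assms(1)
      by simp
  qed (use v in auto)
  then show ?thesis using that by blast
qed

text \<open>The \<open>d\<close> edges of the clique are distinct and \<open>v\<close> has degree at
  most \<open>d\<close>, so there is no room for another edge.\<close>

lemma star_eq_clique:
  assumes cl: "\<And>j k. j < d \<Longrightarrow> k < d \<Longrightarrow> j \<noteq> k \<Longrightarrow> edge_adj E (F j) (F k)"
    and v: "\<And>j. j < d \<Longrightarrow> v \<in> F j"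
  shows "{e \<in> E. v \<in> e} = F ` {..<d}"
proof (rule sym, rule card_seteq)
  have "inj_on F {..<d}"
    using cl unfolding inj_on_def edge_adj_def by blast
  then show "card {e \<in> E. v \<in> e} \<le> card (F ` {..<d})"
    using card_star by (simp add: card_image)
  have "F j \<in> E" if "j < d" for j
    using cl[of j "if j = 0 then 1 else 0"] that d_ge_3 by (auto simp: edge_adj_def split: if_splits)
  then show "F ` {..<d} \<subseteq> {e \<in> E. v \<in> e}" using v by auto
qed (rule finite_star)

text \<open>The first \<open>d\<close> edges already fill the star at the common end, so the last
  one repeats one of them.\<close>

lemma no_large_clique:
  assumes cl: "\<And>j k. j < Suc d \<Longrightarrow> k < Suc d \<Longrightarrow> j \<noteq> k \<Longrightarrow> edge_adj E (F j) (F k)"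
  shows False
proof -
  obtain v where v: "\<And>j. j < Suc d \<Longrightarrow> v \<in> F j"
    using clique_star[of "Suc d" F] cl d_ge_3 by (metis le_SucI)
  have "{e \<in> E. v \<in> e} = F ` {..<d}"
    by (rule star_eq_clique) (use cl v in auto)
  moreover have "F d \<in> E" using cl[of d 0] d_ge_3 by (auto simp: edge_adj_def)
  ultimately obtain j where "j < d" "F d = F j" using v[of d] by blast
  then show False using cl[of d j] by (auto simp: edge_adj_def)
qed

text \<open>If every row and column is centred at the same vertex, the grid is a Latin square on the
  \<open>d\<close> edges there, missing one entry: the symbol missing in row 0 is the one missing in column 0.\<close>

lemma linked_fold:
  assumes row: "\<And>i j k. i < d \<Longrightarrow> j < d \<Longrightarrow> k < d \<Longrightarrow> j \<noteq> k \<Longrightarrow>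
      edge_adj E (corner M x i j) (corner M x i k)"
    and col: "\<And>i j k. j < d \<Longrightarrow> i < d \<Longrightarrow> k < d \<Longrightarrow> i \<noteq> k \<Longrightarrow>
      edge_adj E (corner M y i j) (corner M y k j)"
    and p: "\<And>i j. i < d \<Longrightarrow> j < d \<Longrightarrow> h \<in> corner M x i j"
    and q: "\<And>i j. i < d \<Longrightarrow> j < d \<Longrightarrow> h \<in> corner M y i j"
  shows "x = y"
proof -
  have star_col: "{e \<in> E. h \<in> e} = (\<lambda>i. corner M y i j) ` {..<d}" if "j < d" for j
    by (rule star_eq_clique) (use col q that in auto)
  have "{e \<in> E. h \<in> e} = (\<lambda>j. corner M x 0 j) ` {..<d}"
    by (rule star_eq_clique) (use row p d_ge_3 in auto)
  moreover have "0 \<in> {..<d}" using d_ge_3 by simp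
  ultimately have "corner M x 0 0 \<in> {e \<in> E. h \<in> e}" by blast
  then have xin: "x \<in> {e \<in> E. h \<in> e}" by (simp add: corner_def)
  \<comment> \<open>Every column, with \<open>y\<close> in the corner, is a complete star and hence
    contains \<open>x\<close>; \<open>s j\<close> will be the row where it does.\<close>
  have hit: "\<exists>i<d. corner M y i j = x" if "j < d" for j
    using xin unfolding star_col[OF that] by auto
  then have "\<forall>j\<in>{1..<d}. \<exists>i<d. corner M y i j = x" by auto
  then obtain s where s: "\<And>j. j \<in> {1..<d} \<Longrightarrow> s j < d \<and> corner M y (s j) j = x" by metis
  have s0: "M (s j) j = x" "s j \<in> {1..<d}" if j: "j \<in> {1..<d}" for j
  proof -
    show M: "M (s j) j = x" using s[OF j] j by (auto simp: corner_def split: if_splits)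
    have "s j \<noteq> 0"
    proof
      assume "s j = 0"
      then show False using row[of 0 0 j] M j by (auto simp: corner_def edge_adj_def)
    qed
    then show "s j \<in> {1..<d}" using s[OF j] by auto
  qed
  \<comment> \<open>A row has distinct entries and so holds \<open>x\<close> only once. Hence
    \<open>s\<close> permutes the rows from 1 on.\<close>
  have "inj_on s {1..<d}"
  proof (rule inj_onI, rule ccontr)
    fix j k assume jk: "j \<in> {1..<d}" "k \<in> {1..<d}" "s j = s k" "j \<noteq> k"
    then have "edge_adj E (corner M x (s j) j) (corner M x (s j) k)"
      using row[of "s j" j k] s0(2)[of j] by auto
    then show False using s0[of j] s0[of k] jk by (auto simp: corner_def edge_adj_def)
  qed
  then have surj: "s ` {1..<d} = {1..<d}"
    using s0(2) by (intro card_seteq) (auto simp: card_image)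
  obtain i where i: "i < d" "corner M y i 0 = x"
    using hit[of 0] d_ge_3 by auto
  \<comment> \<open>All rows from 1 on hold their \<open>x\<close> outside column 0, so in column 0
    it can only be the corner, which is \<open>y\<close>.\<close>
  have "i = 0"
  proof (rule ccontr)
    assume "i \<noteq> 0"
    then have "i \<in> s ` {1..<d}" using surj i by auto
    then obtain j where j: "j \<in> {1..<d}" "s j = i" by blast
    then have "edge_adj E (corner M x i j) (corner M x i 0)" using row[of i j 0] i by auto
    then show False using s0[OF j(1)] j i \<open>i \<noteq> 0\<close> by (auto simp: corner_def edge_adj_def)
  qed
  then show ?thesis using i by (simp add: corner_def)
qed

text \<open>Two distinct adjacent edges share a single vertex, so a row crossing two columns centred
  at \<open>h\<close> is itself centred at \<open>h\<close>, and likewise for columns. This spreads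
  from two columns to the rows from 1 on, to the columns from 1 on, and last to row 0 and column 0,
  an order that avoids the missing entry \<open>M 0 0\<close>.\<close>

lemma linked_const:
  assumes row: "\<And>i j k. i < d \<Longrightarrow> j < d \<Longrightarrow> k < d \<Longrightarrow> j \<noteq> k \<Longrightarrow>
      edge_adj E (corner M x i j) (corner M x i k)"
    and col: "\<And>i j k. j < d \<Longrightarrow> i < d \<Longrightarrow> k < d \<Longrightarrow> i \<noteq> k \<Longrightarrow>
      edge_adj E (corner M y i j) (corner M y k j)"
    and p: "\<And>i j. i < d \<Longrightarrow> j < d \<Longrightarrow> p i \<in> corner M x i j"
    and q: "\<And>i j. i < d \<Longrightarrow> j < d \<Longrightarrow> q j \<in> corner M y i j"
    and eq: "j0 < d" "j1 < d" "j0 \<noteq> j1" "q j0 = q j1"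
  shows "x = y"
proof -
  have pM: "p i \<in> M i j" if "i < d" "j < d" "i \<noteq> 0 \<or> j \<noteq> 0" for i j
    using p[of i j] that by (auto simp: corner_def)
  have qM: "q j \<in> M i j" if "i < d" "j < d" "i \<noteq> 0 \<or> j \<noteq> 0" for i j
    using q[of i j] that by (auto simp: corner_def)
  have rowM: "edge_adj E (M i j) (M i k)"
    if "i < d" "j < d" "k < d" "j \<noteq> k" "i \<noteq> 0 \<or> (j \<noteq> 0 \<and> k \<noteq> 0)" for i j k
    using row[of i j k] that by (auto simp: corner_def split: if_splits)
  have colM: "edge_adj E (M i j) (M k j)"
    if "i < d" "j < d" "k < d" "i \<noteq> k" "j \<noteq> 0 \<or> (i \<noteq> 0 \<and> k \<noteq> 0)" for i j k
    using col[of j i k] that by (auto simp: corner_def split: if_splits)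
  define h where "h = q j0"
  have p1: "p i = h" if "i < d" "i \<noteq> 0" for i
    using common_end_unique[OF rowM[of i j0 j1], of "p i" h] pM[of i j0] pM[of i j1]
      qM[of i j0] qM[of i j1] that eq by (simp add: h_def)
  have q1: "q j = h" if "j < d" "j \<noteq> 0" for j
    using common_end_unique[OF colM[of 1 j 2], of "q j" h] pM[of 1 j] pM[of 2 j] qM[of 1 j] qM[of 2 j]
      p1[of 1] p1[of 2] d_ge_3 that by simp
  have p0: "p 0 = h"
    using common_end_unique[OF rowM[of 0 1 2], of "p 0" h] pM[of 0 1] pM[of 0 2] qM[of 0 1] qM[of 0 2]
      q1[of 1] q1[of 2] d_ge_3 by simp
  have q0: "q 0 = h"
    using common_end_unique[OF colM[of 1 0 2], of "q 0" h] pM[of 1 0] pM[of 2 0] qM[of 1 0] qM[of 2 0]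
      p1[of 1] p1[of 2] d_ge_3 by simp
  have "p i = h" "q i = h" if "i < d" for i
    using p0 p1 q0 q1 that by metis+
  then have "h \<in> corner M x i j" "h \<in> corner M y i j" if "i < d" "j < d" for i j
    using p[OF that] q[OF that] that by auto
  then show ?thesis
    by (intro linked_fold[of M x y h]) (blast intro: row col)+
qed

text \<open>Rows and columns are cliques and so have centres \<open>p i\<close> and
  \<open>q j\<close>. If two row centres or two column centres coincide, \<open>linked_const\<close>
  applies; otherwise \<open>M i j\<close> is the edge from \<open>p i\<close> to
  \<open>q j\<close>.\<close>

lemma linked_cases:
  assumes "linked d (edge_adj E) x y"
  obtains "x = y"
  | p q where "inj_on p {..<d}" "inj_on q {..<d}"
      "\<And>i j. i < d \<Longrightarrow> j < d \<Longrightarrow> i \<noteq> 0 \<or> j \<noteq> 0 \<Longrightarrow> {p i, q j} \<in> E"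
      "x \<in> E" "y \<in> E" "p 0 \<in> x" "q 0 \<in> y"
      "\<And>j. 0 < j \<Longrightarrow> j < d \<Longrightarrow> x \<noteq> {p 0, q j}" "\<And>i. 0 < i \<Longrightarrow> i < d \<Longrightarrow> y \<noteq> {p i, q 0}"
proof -
  obtain M where
    "\<forall>i<d. \<forall>j<d. \<forall>k<d. j \<noteq> k \<longrightarrow> edge_adj E (corner M x i j) (corner M x i k)"
    "\<forall>j<d. \<forall>i<d. \<forall>k<d. i \<noteq> k \<longrightarrow> edge_adj E (corner M y i j) (corner M y k j)"
    using assms unfolding linked_def by blast
  then have
    row: "\<And>i j k. i < d \<Longrightarrow> j < d \<Longrightarrow> k < d \<Longrightarrow> j \<noteq> k \<Longrightarrow>
      edge_adj E (corner M x i j) (corner M x i k)" and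
    col: "\<And>i j k. j < d \<Longrightarrow> i < d \<Longrightarrow> k < d \<Longrightarrow> i \<noteq> k \<Longrightarrow>
      edge_adj E (corner M y i j) (corner M y k j)"
    by simp_all
  have "\<exists>v. \<forall>j<d. v \<in> corner M x i j" if "i < d" for i
    by (rule clique_star[OF d_ge_3, of "corner M x i"]) (use row that in blast)+
  then obtain p where p: "\<And>i j. i < d \<Longrightarrow> j < d \<Longrightarrow> p i \<in> corner M x i j" by metis
  have "\<exists>v. \<forall>i<d. v \<in> corner M y i j" if "j < d" for j
    by (rule clique_star[OF d_ge_3, of "\<lambda>i. corner M y i j"]) (use col that in blast)+
  then obtain q where q: "\<And>i j. i < d \<Longrightarrow> j < d \<Longrightarrow> q j \<in> corner M y i j" by metis
  have T: "corner (\<lambda>i j. M j i) z i j = corner M z j i" for z i j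
    by (auto simp: corner_def)
  show ?thesis
  proof (cases "inj_on q {..<d} \<and> inj_on p {..<d}")
    case False
    have "x = y"
    proof (cases "inj_on q {..<d}")
      case False
      then obtain j k where "j < d" "k < d" "j \<noteq> k" "q j = q k" by (auto simp: inj_on_def)
      then show ?thesis
        by (intro linked_const[of M x y p q j k]) (blast intro: row col p q)+
    next
      case True
      then obtain j k where "j < d" "k < d" "j \<noteq> k" "p j = p k"
        using False by (auto simp: inj_on_def)
      \<comment> \<open>Transposing the grid exchanges rows with columns and \<open>x\<close> with
        \<open>y\<close>.\<close>
      then have "y = x"
        by (intro linked_const[of "\<lambda>i j. M j i" y x q p j k]) (simp_all add: T row col p q)
      then show ?thesis by simp
    qed
    then show ?thesis by (rule that(1))
  next
    case True
    then have inj: "inj_on q {..<d}" "inj_on p {..<d}" by auto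
    have qne: "q j \<noteq> q k" if "j < d" "k < d" "j \<noteq> k" for j k
      using inj(1) that by (auto simp: inj_on_def)
    have pne: "p j \<noteq> p k" if "j < d" "k < d" "j \<noteq> k" for j k
      using inj(2) that by (auto simp: inj_on_def)
    have MM: "p i \<in> M i j" "q j \<in> M i j" "M i j \<in> E"
      if "i < d" "j < d" "i \<noteq> 0 \<or> j \<noteq> 0" for i j
    proof -
      show "p i \<in> M i j" using p[of i j] that by (auto simp: corner_def)
      show "q j \<in> M i j" using q[of i j] that by (auto simp: corner_def)
      show "M i j \<in> E"
        using row[of i j "if j = 0 then 1 else 0"] that d_ge_3
        by (auto simp: corner_def edge_adj_def split: if_splits)
    qed
    have Meq: "M i j = {p i, q j}"
      if "i < d" "j < d" "i \<noteq> 0 \<or> j \<noteq> 0" "p i \<noteq> q j" for i j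
      using edge_eq MM that by metis
    have third: "\<exists>k<d. k \<noteq> a \<and> k \<noteq> b" for a b :: nat
    proof -
      have "0 < d" "1 < d" "2 < d" using d_ge_3 by auto
      moreover have "(0 \<noteq> a \<and> 0 \<noteq> b) \<or> (1 \<noteq> a \<and> 1 \<noteq> b) \<or> (2 \<noteq> a \<and> 2 \<noteq> b)" by auto
      ultimately show ?thesis by blast
    qed
    \<comment> \<open>If \<open>p i = q j\<close>, this vertex is joined to \<open>p i'\<close> and
      to each \<open>q j'\<close> with \<open>j' \<noteq> j\<close>. Without triangles
      \<open>p i' = q j'\<close> for two such \<open>j'\<close>, against injectivity. Taking
      \<open>i'\<close> nonzero avoids the missing entry.\<close>
    have P: "p i \<noteq> q j" if i: "i < d" "j < d" "i \<noteq> 0" for i j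
    proof
      assume eq: "p i = q j"
      obtain i' where i': "i' < d" "i' \<noteq> 0" "i' \<noteq> i" using third by metis
      have e1: "{p i', q j} \<in> E"
        using Meq[of i' j] MM(3)[of i' j] pne[of i' i] eq i' i by auto
      have "p i' = q j'" if j': "j' < d" "j' \<noteq> j" for j'
      proof (rule ccontr)
        assume "p i' \<noteq> q j'"
        then have "{p i', q j'} \<in> E" using Meq[of i' j'] MM(3)[of i' j'] i' j' by auto
        moreover have "{p i, q j'} \<in> E"
          using Meq[of i j'] MM(3)[of i j'] i j' eq qne[of j j'] by auto
        ultimately show False
          using no_triangle[of "p i'" "q j" "q j'"] e1 eq by simp
      qed
      moreover obtain j1 where j1: "j1 < d" "j1 \<noteq> j" using third by metis
      moreover obtain j2 where j2: "j2 < d" "j2 \<noteq> j" "j2 \<noteq> j1" using third by metis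
      ultimately show False using qne[of j1 j2] by metis
    qed
    \<comment> \<open>Only \<open>i = 0\<close> is new; then \<open>p 1\<close>, \<open>q j\<close>
      and \<open>q j'\<close> would form a triangle.\<close>
    have Q: "p i \<noteq> q j" if i: "i < d" "j < d" "j \<noteq> 0" for i j
    proof (cases "i = 0")
      case True
      show ?thesis
      proof
        assume eq: "p i = q j"
        obtain j' where j': "j' < d" "j' \<noteq> 0" "j' \<noteq> j" using third by metis
        have a: "{p 1, q j} \<in> E" using Meq[of 1 j] MM(3)[of 1 j] P[of 1 j] d_ge_3 i by auto
        have b: "{p 1, q j'} \<in> E" using Meq[of 1 j'] MM(3)[of 1 j'] P[of 1 j'] d_ge_3 j' by auto
        have "{p i, q j'} \<in> E"
          using Meq[of i j'] MM(3)[of i j'] i j' eq qne[of j j'] by auto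
        then show False using no_triangle[of "p 1" "q j" "q j'"] a b eq by simp
      qed
    qed (use P i in auto)
    have edges: "{p i, q j} \<in> E" "M i j = {p i, q j}"
      if "i < d" "j < d" "i \<noteq> 0 \<or> j \<noteq> 0" for i j
      using Meq[of i j] MM(3)[of i j] P[of i j] Q[of i j] that by auto
    show ?thesis
    proof (rule that(2)[OF inj(2,1) edges(1)])
      have r: "edge_adj E x (M 0 j)" if "0 < j" "j < d" for j
        using row[of 0 0 j] that by (auto simp: corner_def)
      have c: "edge_adj E y (M i 0)" if "0 < i" "i < d" for i
        using col[of 0 0 i] that by (auto simp: corner_def)
      show "x \<in> E" "y \<in> E" using r[of 1] c[of 1] d_ge_3 by (auto simp: edge_adj_def)
      show "p 0 \<in> x" "q 0 \<in> y" using p[of 0 0] q[of 0 0] d_ge_3 by (auto simp: corner_def)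
      show "x \<noteq> {p 0, q j}" if "0 < j" "j < d" for j
        using r[OF that] edges(2)[of 0 j] that by (auto simp: edge_adj_def)
      show "y \<noteq> {p i, q 0}" if "0 < i" "i < d" for i
        using c[OF that] edges(2)[of i 0] that by (auto simp: edge_adj_def)
    qed auto
  qed
qed

end

section \<open>Rings of gadgets\<close>

text \<open>
  Unit \<open>i < m\<close> of the ring of length \<open>m\<close> is named \<open>(m, i)\<close>. Its skeleton is the tree with edges
  \<open>V0 V1\<close>, \<open>V0 W0\<close>, \<open>V1 U1\<close>, \<open>U1 W1\<close>, \<open>U1 W2\<close>. The gadgets \<open>G0\<close>, \<open>G1\<close>, \<open>G2\<close> are loops at \<open>W0\<close>, \<open>W1\<close>,
  \<open>W2\<close>, and \<open>GC\<close> connects \<open>V1\<close> to the vertex \<open>V0\<close> of the next unit. \<open>Lft u g i\<close> and \<open>Rgt u g j\<close> are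
  the vertices \<open>a\<^sub>i\<close> and \<open>b\<^sub>j\<close> of gadget \<open>g\<close> in unit \<open>u\<close>.
\<close>

datatype part = V0 | V1 | U1 | W0 | W1 | W2

datatype gadget = G0 | G1 | G2 | GC

datatype vertex = Sk "nat \<times> nat" part | Lft "nat \<times> nat" gadget nat | Rgt "nat \<times> nat" gadget nat

instance part :: countable by countable_datatype
instance gadget :: countable by countable_datatype
instance vertex :: countable by countable_datatype

definition sk_adj :: "part \<Rightarrow> part \<Rightarrow> bool" where
  "sk_adj p q \<longleftrightarrow> {p, q} \<in> {{V0, V1}, {V0, W0}, {V1, U1}, {U1, W1}, {U1, W2}}"

fun lport :: "gadget \<Rightarrow> part" where
  "lport G0 = W0" | "lport G1 = W1" | "lport G2 = W2" | "lport GC = V1"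

fun rport :: "gadget \<Rightarrow> part" where
  "rport G0 = W0" | "rport G1 = W1" | "rport G2 = W2" | "rport GC = V0"

fun nxt :: "nat \<times> nat \<Rightarrow> nat \<times> nat" where
  "nxt (m, i) = (m, Suc i mod m)"

definition runit :: "gadget \<Rightarrow> nat \<times> nat \<Rightarrow> nat \<times> nat" where
  "runit g u = (if g = GC then nxt u else u)"

fun vadj :: "vertex \<Rightarrow> vertex \<Rightarrow> bool" where
  "vadj (Sk u p) (Sk v q) \<longleftrightarrow> u = v \<and> sk_adj p q"
| "vadj (Sk u p) (Lft v g i) \<longleftrightarrow> i = 0 \<and> u = v \<and> p = lport g"
| "vadj (Lft v g i) (Sk u p) \<longleftrightarrow> i = 0 \<and> u = v \<and> p = lport g"
| "vadj (Sk u p) (Rgt v g j) \<longleftrightarrow> j = 0 \<and> u = runit g v \<and> p = rport g"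
| "vadj (Rgt v g j) (Sk u p) \<longleftrightarrow> j = 0 \<and> u = runit g v \<and> p = rport g"
| "vadj (Lft u g i) (Rgt v h j) \<longleftrightarrow> u = v \<and> g = h \<and> (i \<noteq> 0 \<or> j \<noteq> 0)"
| "vadj (Rgt v h j) (Lft u g i) \<longleftrightarrow> u = v \<and> g = h \<and> (i \<noteq> 0 \<or> j \<noteq> 0)"
| "vadj (Lft _ _ _) (Lft _ _ _) \<longleftrightarrow> False"
| "vadj (Rgt _ _ _) (Rgt _ _ _) \<longleftrightarrow> False"

definition units :: "nat set \<Rightarrow> (nat \<times> nat) set" where
  "units S = Sigma S lessThan"

fun valid :: "nat \<Rightarrow> nat set \<Rightarrow> vertex \<Rightarrow> bool" where
  "valid d S (Sk u p) \<longleftrightarrow> u \<in> units S"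
| "valid d S (Lft u g i) \<longleftrightarrow> u \<in> units S \<and> i < d"
| "valid d S (Rgt u g j) \<longleftrightarrow> u \<in> units S \<and> j < d"

definition ring_graph :: "nat \<Rightarrow> nat set \<Rightarrow> vertex graph" where
  "ring_graph d S = \<lparr>verts = {x. valid d S x},
     edges = {{x, y} | x y. valid d S x \<and> valid d S y \<and> vadj x y}\<rparr>"

definition ldang :: "nat \<times> nat \<Rightarrow> gadget \<Rightarrow> vertex set" where
  "ldang u g = {Lft u g 0, Sk u (lport g)}"

definition rdang :: "nat \<times> nat \<Rightarrow> gadget \<Rightarrow> vertex set" where
  "rdang u g = {Rgt u g 0, Sk (runit g u) (rport g)}"

lemma nxt_units: "u \<in> units S \<Longrightarrow> nxt u \<in> units S"
  by (cases u) (auto simp: units_def)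

lemma runit_units: "u \<in> units S \<Longrightarrow> runit g u \<in> units S"
  by (simp add: runit_def nxt_units)

lemma nxt_inj:
  assumes "u \<in> units S" "v \<in> units S" "nxt u = nxt v" shows "u = v"
  using assms by (cases u; cases v) (auto simp: units_def mod_Suc split: if_splits)

lemma sk_adj_sym: "sk_adj p q \<longleftrightarrow> sk_adj q p"
  by (simp add: sk_adj_def insert_commute)

lemma sk_adj_irrefl: "\<not> sk_adj p p"
  by (auto simp: sk_adj_def doubleton_eq_iff)

lemma vadj_sym: "vadj x y \<Longrightarrow> vadj y x"
  by (cases x; cases y) (auto simp: sk_adj_sym)

lemma vadj_irrefl: "\<not> vadj x x"
  by (cases x) (auto simp: sk_adj_irrefl)

lemma sk_nbrs:
  "sk_adj V0 q \<longleftrightarrow> q = V1 \<or> q = W0" "sk_adj V1 q \<longleftrightarrow> q = V0 \<or> q = U1"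
  "sk_adj U1 q \<longleftrightarrow> q = V1 \<or> q = W1 \<or> q = W2" "sk_adj W0 q \<longleftrightarrow> q = V0"
  "sk_adj W1 q \<longleftrightarrow> q = U1" "sk_adj W2 q \<longleftrightarrow> q = U1"
  by (cases q; simp add: sk_adj_def doubleton_eq_iff)+

lemma port_iff:
  "W0 = lport g \<longleftrightarrow> g = G0" "W1 = lport g \<longleftrightarrow> g = G1" "W2 = lport g \<longleftrightarrow> g = G2"
  "V1 = lport g \<longleftrightarrow> g = GC" "V0 \<noteq> lport g" "U1 \<noteq> lport g"
  "W0 = rport g \<longleftrightarrow> g = G0" "W1 = rport g \<longleftrightarrow> g = G1" "W2 = rport g \<longleftrightarrow> g = G2"
  "V0 = rport g \<longleftrightarrow> g = GC" "V1 \<noteq> rport g" "U1 \<noteq> rport g"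
  by (cases g; simp)+

lemma vadj_nbrs:
  "vadj (Sk u V0) y \<longleftrightarrow> y = Sk u V1 \<or> y = Sk u W0 \<or> (\<exists>v. u = nxt v \<and> y = Rgt v GC 0)"
  "vadj (Sk u V1) y \<longleftrightarrow> y = Sk u V0 \<or> y = Sk u U1 \<or> y = Lft u GC 0"
  "vadj (Sk u U1) y \<longleftrightarrow> y = Sk u V1 \<or> y = Sk u W1 \<or> y = Sk u W2"
  "vadj (Sk u W0) y \<longleftrightarrow> y = Sk u V0 \<or> y = Lft u G0 0 \<or> y = Rgt u G0 0"
  "vadj (Sk u W1) y \<longleftrightarrow> y = Sk u U1 \<or> y = Lft u G1 0 \<or> y = Rgt u G1 0"
  "vadj (Sk u W2) y \<longleftrightarrow> y = Sk u U1 \<or> y = Lft u G2 0 \<or> y = Rgt u G2 0"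
  by (cases y; auto simp: sk_nbrs port_iff runit_def)+

lemma ring_edge_iff:
  "{x, y} \<in> edges (ring_graph d S) \<longleftrightarrow> valid d S x \<and> valid d S y \<and> vadj x y"
  by (auto simp: ring_graph_def doubleton_eq_iff dest: vadj_sym)

lemma ring_edge_other:
  assumes "e \<in> edges (ring_graph d S)" "v \<in> e"
  obtains y where "e = {v, y}" "valid d S v" "valid d S y" "vadj v y"
  using assms vadj_sym by (fastforce simp: ring_graph_def insert_commute)

lemma ring_edge_ends:
  assumes "e \<in> edges (ring_graph d S)"
  obtains x y where "e = {x, y}" "valid d S x" "valid d S y" "vadj x y"
  using assms by (auto simp: ring_graph_def)

lemma finite_units:
  assumes "finite S" shows "finite (units S)"
  using assms by (simp add: units_def)

lemma finite_ring_graph: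
  assumes "finite S" shows "finite_graph (ring_graph d S)"
proof -
  have part: "finite (UNIV :: part set)"
    by (rule finite_subset[of _ "{V0, V1, U1, W0, W1, W2}"]) (auto intro: part.exhaust)
  have gad: "finite (UNIV :: gadget set)"
    by (rule finite_subset[of _ "{G0, G1, G2, GC}"]) (auto intro: gadget.exhaust)
  have "{x. valid d S x} \<subseteq> (\<lambda>(u, p). Sk u p) ` (units S \<times> UNIV) \<union>
      (\<lambda>(u, g, i). Lft u g i) ` (units S \<times> UNIV \<times> {..<d}) \<union>
      (\<lambda>(u, g, i). Rgt u g i) ` (units S \<times> UNIV \<times> {..<d})"
  proof
    fix x assume "x \<in> {x. valid d S x}"
    then show "x \<in> (\<lambda>(u, p). Sk u p) ` (units S \<times> UNIV) \<union>
      (\<lambda>(u, g, i). Lft u g i) ` (units S \<times> UNIV \<times> {..<d}) \<union>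
      (\<lambda>(u, g, i). Rgt u g i) ` (units S \<times> UNIV \<times> {..<d})"
      by (cases x) (auto simp: image_iff)
  qed
  then have "finite {x. valid d S x}"
    by (rule finite_subset) (use finite_units[OF assms] part gad in auto)
  then show ?thesis
    using vadj_irrefl by (fastforce simp: finite_graph_def ring_graph_def card_2_iff)
qed

text \<open>Numbering the edges at each vertex bounds all degrees by 3 or \<open>d\<close>, and a map that preserves
  the numbering is injective on neighbourhoods.\<close>

definition sk_slot :: "part \<Rightarrow> part \<Rightarrow> nat" where
  "sk_slot p q = (if (p, q) \<in> {(V0, V1), (U1, V1)} then 0
     else if (p, q) \<in> {(V1, V0), (U1, W1)} then 1 else 2)"

fun slot :: "vertex \<Rightarrow> vertex \<Rightarrow> nat" where
  "slot (Sk u p) (Sk v q) = sk_slot p q"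
| "slot (Sk u p) (Lft v g i) = 0"
| "slot (Sk u p) (Rgt v g j) = 1"
| "slot (Lft u g i) (Rgt v h j) = j"
| "slot (Rgt u g j) (Lft v h i) = i"
| "slot _ _ = 0"

lemma slot_less:
  assumes "d \<ge> 3" "valid d S x" "valid d S y" "vadj x y"
  shows "slot x y < d"
  using assms by (cases x; cases y) (auto simp: sk_slot_def)

text \<open>Validity enters at \<open>V0\<close>: \<open>nxt\<close> is injective on units, so just
  one \<open>GC\<close> ends there.\<close>

lemma slot_inj:
  assumes "valid d S y" "valid d S z" "vadj x y" "vadj x z" "slot x y = slot x z"
  shows "y = z"
proof (cases x)
  case (Sk u p)
  then show ?thesis
    using assms nxt_inj[of _ S]
    by (cases p) (auto simp: vadj_nbrs sk_slot_def)
next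
  case (Lft u g i)
  then show ?thesis using assms by (cases y; cases z) auto
next
  case (Rgt u g i)
  then show ?thesis using assms by (cases y; cases z) auto
qed

lemma vadj_no_triangle:
  assumes "vadj x y" "vadj y z" "vadj x z" shows False
proof (cases x)
  case (Sk u p)
  then show ?thesis
    using assms by (cases p) (auto simp: vadj_nbrs sk_nbrs port_iff)
next
  case (Lft u g i)
  then show ?thesis using assms by (cases y; cases z) (auto simp: sk_adj_irrefl)
next
  case (Rgt u g i)
  then show ?thesis using assms by (cases y; cases z) (auto simp: sk_adj_irrefl)
qed

text \<open>No skeleton vertex lies on a 4-cycle, whereas two vertices on one side of a gadget have
  two common neighbours if \<open>d \<ge> 3\<close>. This keeps images of gadget vertices off the
  skeleton.\<close>

lemma sk_no_square:
  assumes "vadj (Sk u p) y" "vadj (Sk u p) z" "y \<noteq> z" "vadj w y" "vadj w z"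
  shows "w = Sk u p"
proof (cases w)
  case (Sk v q)
  then show ?thesis
    using assms by (cases p; cases q) (auto simp: vadj_nbrs)
next
  case (Lft v g i)
  then show ?thesis using assms by (cases y; cases z) auto
next
  case (Rgt v g i)
  then show ?thesis using assms by (cases y; cases z) auto
qed

lemma triangle_free_ring:
  assumes "d \<ge> 3" shows "triangle_free_graph (edges (ring_graph d S)) d"
proof
  show "card e = 2" if "e \<in> edges (ring_graph d S)" for e
    using that vadj_irrefl by (fastforce simp: ring_graph_def card_2_iff)
  show False if "{x, y} \<in> edges (ring_graph d S)" "{y, z} \<in> edges (ring_graph d S)"
    "{x, z} \<in> edges (ring_graph d S)" for x y z
    using that vadj_no_triangle by (auto simp: ring_edge_iff)
  fix v
  let ?N = "{y. valid d S v \<and> valid d S y \<and> vadj v y}"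
  have inj: "inj_on (slot v) ?N"
    using slot_inj by (auto simp: inj_on_def)
  have sub: "slot v ` ?N \<subseteq> {..<d}"
    using slot_less[OF assms] by auto
  have fin: "finite ?N" using inj_on_finite[OF inj sub] by simp
  have eq: "{e \<in> edges (ring_graph d S). v \<in> e} = (\<lambda>y. {v, y}) ` ?N"
    by (auto simp: ring_edge_iff elim: ring_edge_other)
  show "finite {e \<in> edges (ring_graph d S). v \<in> e}"
    unfolding eq using fin by simp
  have "card ?N \<le> card {..<d}" using card_inj_on_le[OF inj sub] by simp
  then show "card {e \<in> edges (ring_graph d S). v \<in> e} \<le> d"
    unfolding eq using card_image_le[OF fin, of "\<lambda>y. {v, y}"] by simp
qed (fact assms)

section \<open>Recovering gadgets, anchors and steps from the line graph of a ring\<close>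

definition hub_edge :: "nat \<times> nat \<Rightarrow> vertex set" where "hub_edge u = {Sk u V0, Sk u V1}"

definition stem :: "nat \<times> nat \<Rightarrow> vertex set" where "stem u = {Sk u U1, Sk u V1}"

definition twig1 :: "nat \<times> nat \<Rightarrow> vertex set" where "twig1 u = {Sk u U1, Sk u W1}"

definition twig2 :: "nat \<times> nat \<Rightarrow> vertex set" where "twig2 u = {Sk u U1, Sk u W2}"

lemmas edge_names = hub_edge_def stem_def twig1_def twig2_def ldang_def rdang_def

lemma edge_names_distinct:
  "hub_edge u \<noteq> stem v" "hub_edge u \<noteq> twig1 v" "hub_edge u \<noteq> twig2 v" "hub_edge u \<noteq> ldang v g" "hub_edge u \<noteq> rdang v g"
  "stem u \<noteq> twig1 v" "stem u \<noteq> twig2 v" "stem u \<noteq> ldang v g" "stem u \<noteq> rdang v g"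
  "twig1 u \<noteq> twig2 v" "twig1 u \<noteq> ldang v g" "twig1 u \<noteq> rdang v g" "twig2 u \<noteq> ldang v g" "twig2 u \<noteq> rdang v g"
  "ldang u h \<noteq> rdang v g"
  by (auto simp: edge_names doubleton_eq_iff)

lemma edge_names_inject:
  "hub_edge u = hub_edge v \<longleftrightarrow> u = v" "stem u = stem v \<longleftrightarrow> u = v" "twig1 u = twig1 v \<longleftrightarrow> u = v" "twig2 u = twig2 v \<longleftrightarrow> u = v"
  "ldang u g = ldang v h \<longleftrightarrow> u = v \<and> g = h" "rdang u g = rdang v h \<longleftrightarrow> u = v \<and> g = h"
  by (auto simp: edge_names doubleton_eq_iff)

context
  fixes d :: nat
  assumes d3: "d \<ge> 3"
begin

interpretation ring: triangle_free_graph "edges (ring_graph d S)" d for S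
  using d3 by (rule triangle_free_ring)

abbreviation radj :: "nat set \<Rightarrow> vertex set \<Rightarrow> vertex set \<Rightarrow> bool" where
  "radj S \<equiv> edge_adj (edges (ring_graph d S))"

lemma Lft_edge:
  assumes "x \<in> edges (ring_graph d S)" "Lft u g 0 \<in> x"
    "\<And>j. j < d \<Longrightarrow> j > 0 \<Longrightarrow> x \<noteq> {Lft u g 0, Rgt u g j}"
  shows "x = ldang u g"
proof -
  obtain y where y: "x = {Lft u g 0, y}" "valid d S y" "vadj (Lft u g 0) y"
    using ring_edge_other[OF assms(1,2)] .
  then show ?thesis using assms(3) by (cases y) (auto simp: ldang_def)
qed

lemma Rgt_edge:
  assumes "x \<in> edges (ring_graph d S)" "Rgt u g 0 \<in> x"
    "\<And>i. i < d \<Longrightarrow> i > 0 \<Longrightarrow> x \<noteq> {Lft u g i, Rgt u g 0}"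
  shows "x = rdang u g"
proof -
  obtain y where y: "x = {Rgt u g 0, y}" "valid d S y" "vadj (Rgt u g 0) y"
    using ring_edge_other[OF assms(1,2)] .
  then show ?thesis using assms(3) by (cases y) (auto simp: rdang_def insert_commute)
qed

lemma onto_less:
  fixes f :: "nat \<Rightarrow> nat"
  assumes "inj_on f {..<d}" "\<And>i. i < d \<Longrightarrow> f i < d" "j < d"
  obtains i where "i < d" "f i = j"
proof -
  have "f ` {..<d} = {..<d}"
    using assms(1,2) by (intro card_seteq) (auto simp: card_image)
  then have "j \<in> f ` {..<d}" using assms(3) by simp
  then show ?thesis using that by blast
qed

text \<open>Both maps permute the indices, so some pair is sent to \<open>(0, 0)\<close>; by
  \<open>ne\<close> it can only be \<open>(0, 0)\<close> itself.\<close>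

lemma gadget_corner:
  assumes inj: "inj_on \<sigma> {..<d}" "inj_on \<tau> {..<d}"
    and lt: "\<forall>i<d. \<sigma> i < d" "\<forall>j<d. \<tau> j < d"
    and ne: "\<forall>i<d. \<forall>j<d. i \<noteq> 0 \<or> j \<noteq> 0 \<longrightarrow> \<sigma> i \<noteq> 0 \<or> \<tau> j \<noteq> (0 :: nat)"
  shows "\<sigma> 0 = 0" "\<tau> 0 = 0"
    "\<And>j. j < d \<Longrightarrow> j > 0 \<Longrightarrow> \<exists>i. 0 < i \<and> i < d \<and> \<sigma> i = j"
    "\<And>j. j < d \<Longrightarrow> j > 0 \<Longrightarrow> \<exists>i. 0 < i \<and> i < d \<and> \<tau> i = j"
proof -
  obtain i where i: "i < d" "\<sigma> i = 0" using onto_less[OF inj(1) lt(1)[rule_format], of 0] d3 by auto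
  obtain j where j: "j < d" "\<tau> j = 0" using onto_less[OF inj(2) lt(2)[rule_format], of 0] d3 by auto
  have "\<not> (i \<noteq> 0 \<or> j \<noteq> 0)" using ne i j by blast
  then have "i = 0" "j = 0" by auto
  then show 0: "\<sigma> 0 = 0" "\<tau> 0 = 0" using i j by auto
  show "\<exists>i. 0 < i \<and> i < d \<and> \<sigma> i = j" if "j < d" "j > 0" for j
    using onto_less[OF inj(1) lt(1)[rule_format] that(1)] that 0 by (metis gr_zeroI)
  show "\<exists>i. 0 < i \<and> i < d \<and> \<tau> i = j" if "j < d" "j > 0" for j
    using onto_less[OF inj(2) lt(2)[rule_format] that(1)] that 0 by (metis gr_zeroI)
qed

lemma linked_ring:
  assumes "linked d (radj S) x y" "x \<noteq> y"
  obtains u g where "u \<in> units S" "{x, y} = {ldang u g, rdang u g}"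
  using assms(1)
proof (cases rule: ring.linked_cases)
  case 1
  then show ?thesis using assms(2) by simp
next
  case (2 p q)
  note inj = 2(1,2) and xy = 2(4-9)
  have pq: "valid d S (p i)" "valid d S (q j)" "vadj (p i) (q j)" "vadj (q j) (p i)"
    if "i < d" "j < d" "i \<noteq> 0 \<or> j \<noteq> 0" for i j
    using 2(3)[OF that] vadj_sym by (auto simp: ring_edge_iff)
  have pne: "p i \<noteq> p j" and qne: "q i \<noteq> q j" if "i < d" "j < d" "i \<noteq> j" for i j
    using inj that by (auto simp: inj_on_def)
  \<comment> \<open>\<open>p i\<close> and \<open>p k\<close> have the common neighbours
    \<open>q 1\<close> and \<open>q 2\<close>, so \<open>sk_no_square\<close> would give
    \<open>p k = p i\<close>.\<close>
  have pSk: "p i \<noteq> Sk u r" if "i < d" for i u r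
  proof
    assume "p i = Sk u r"
    define k where "k = (if i = 1 then 2 else 1 :: nat)"
    have k: "k < d" "k \<noteq> i" "k \<noteq> 0" using d3 by (auto simp: k_def)
    then have "p k = Sk u r"
      using sk_no_square[of u r "q 1" "q 2" "p k"] pq(3)[of i 1] pq(3)[of i 2] pq(3)[of k 1]
        pq(3)[of k 2] qne[of 1 2] d3 that \<open>p i = Sk u r\<close> by simp
    then show False using pne[of i k] k that \<open>p i = Sk u r\<close> by simp
  qed
  have qSk: "q i \<noteq> Sk u r" if "i < d" for i u r
  proof
    assume "q i = Sk u r"
    define k where "k = (if i = 1 then 2 else 1 :: nat)"
    have k: "k < d" "k \<noteq> i" "k \<noteq> 0" using d3 by (auto simp: k_def)
    then have "q k = Sk u r"
      using sk_no_square[of u r "p 1" "p 2" "q k"] pq(4)[of 1 i] pq(4)[of 2 i] pq(4)[of 1 k]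
        pq(4)[of 2 k] pne[of 1 2] d3 that \<open>q i = Sk u r\<close> by simp
    then show False using qne[of i k] k that \<open>q i = Sk u r\<close> by simp
  qed
  have d01: "0 < d" "1 < d" using d3 by auto
  show ?thesis
  \<comment> \<open>Row 1 misses no entry, so \<open>p 1\<close> is adjacent to every
    \<open>q j\<close>. In the cases \<open>Lft\<close> and \<open>Rgt\<close> the sides are kept
    and exchanged, respectively.\<close>
  proof (cases "p 1")
    case (Sk u r)
    then show ?thesis using pSk d01 by blast
  next
    case (Lft u g k)
    have "\<exists>n. q j = Rgt u g n \<and> n < d" if "j < d" for j
      using pq(2,3)[of 1 j] qSk[OF that] that d01 Lft by (cases "q j") auto
    then obtain \<tau> where \<tau>: "\<And>j. j < d \<Longrightarrow> q j = Rgt u g (\<tau> j) \<and> \<tau> j < d" by metis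
    have "\<exists>n. p j = Lft u g n \<and> n < d" if "j < d" for j
      using pq(1,3)[of j 1] pSk[OF that] that d01 \<tau>[of 1] by (cases "p j") auto
    then obtain \<sigma> where \<sigma>: "\<And>j. j < d \<Longrightarrow> p j = Lft u g (\<sigma> j) \<and> \<sigma> j < d" by metis
    have inj': "inj_on \<sigma> {..<d}" "inj_on \<tau> {..<d}"
    proof -
      show "inj_on \<sigma> {..<d}"
      proof (rule inj_onI)
        fix a b assume "a \<in> {..<d}" "b \<in> {..<d}" "\<sigma> a = \<sigma> b"
        then show "a = b" using pne[of a b] \<sigma>[of a] \<sigma>[of b] by auto
      qed
      show "inj_on \<tau> {..<d}"
      proof (rule inj_onI)
        fix a b assume "a \<in> {..<d}" "b \<in> {..<d}" "\<tau> a = \<tau> b"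
        then show "a = b" using qne[of a b] \<tau>[of a] \<tau>[of b] by auto
      qed
    qed
    have lt: "\<forall>i<d. \<sigma> i < d" "\<forall>j<d. \<tau> j < d" using \<sigma> \<tau> by auto
    have "\<sigma> i \<noteq> 0 \<or> \<tau> j \<noteq> 0" if "i < d" "j < d" "i \<noteq> 0 \<or> j \<noteq> 0" for i j
      using pq(3)[OF that] \<sigma>[OF that(1)] \<tau>[OF that(2)] by auto
    then have ne: "\<forall>i<d. \<forall>j<d. i \<noteq> 0 \<or> j \<noteq> 0 \<longrightarrow> \<sigma> i \<noteq> 0 \<or> \<tau> j \<noteq> 0" by blast
    note c = gadget_corner[OF inj' lt ne]
    have "x = ldang u g"
    proof (rule Lft_edge[OF xy(1)])
      show "Lft u g 0 \<in> x" using xy(3) \<sigma>[OF d01(1)] c(1) by simp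
      fix j assume j: "j < d" "0 < j"
      obtain i where "0 < i" "i < d" "\<tau> i = j" using c(4)[OF j] by blast
      then show "x \<noteq> {Lft u g 0, Rgt u g j}" using xy(5)[of i] \<sigma>[OF d01(1)] c(1) \<tau>[of i] by simp
    qed
    moreover have "y = rdang u g"
    proof (rule Rgt_edge[OF xy(2)])
      show "Rgt u g 0 \<in> y" using xy(4) \<tau>[OF d01(1)] c(2) by simp
      fix j assume j: "j < d" "0 < j"
      obtain i where "0 < i" "i < d" "\<sigma> i = j" using c(3)[OF j] by blast
      then show "y \<noteq> {Lft u g j, Rgt u g 0}" using xy(6)[of i] \<tau>[OF d01(1)] c(2) \<sigma>[of i] by simp
    qed
    moreover have "u \<in> units S" using pq(1)[of 1 1] Lft d01 by auto
    ultimately show ?thesis using that by simp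
  next
    case (Rgt u g k)
    have "\<exists>n. q j = Lft u g n \<and> n < d" if "j < d" for j
      using pq(2,3)[of 1 j] qSk[OF that] that d01 Rgt by (cases "q j") auto
    then obtain \<tau> where \<tau>: "\<And>j. j < d \<Longrightarrow> q j = Lft u g (\<tau> j) \<and> \<tau> j < d" by metis
    have "\<exists>n. p j = Rgt u g n \<and> n < d" if "j < d" for j
      using pq(1,3)[of j 1] pSk[OF that] that d01 \<tau>[of 1] by (cases "p j") auto
    then obtain \<sigma> where \<sigma>: "\<And>j. j < d \<Longrightarrow> p j = Rgt u g (\<sigma> j) \<and> \<sigma> j < d" by metis
    have inj': "inj_on \<sigma> {..<d}" "inj_on \<tau> {..<d}"
    proof -
      show "inj_on \<sigma> {..<d}"
      proof (rule inj_onI)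
        fix a b assume "a \<in> {..<d}" "b \<in> {..<d}" "\<sigma> a = \<sigma> b"
        then show "a = b" using pne[of a b] \<sigma>[of a] \<sigma>[of b] by auto
      qed
      show "inj_on \<tau> {..<d}"
      proof (rule inj_onI)
        fix a b assume "a \<in> {..<d}" "b \<in> {..<d}" "\<tau> a = \<tau> b"
        then show "a = b" using qne[of a b] \<tau>[of a] \<tau>[of b] by auto
      qed
    qed
    have lt: "\<forall>i<d. \<sigma> i < d" "\<forall>j<d. \<tau> j < d" using \<sigma> \<tau> by auto
    have "\<sigma> i \<noteq> 0 \<or> \<tau> j \<noteq> 0" if "i < d" "j < d" "i \<noteq> 0 \<or> j \<noteq> 0" for i j
      using pq(3)[OF that] \<sigma>[OF that(1)] \<tau>[OF that(2)] by auto
    then have ne: "\<forall>i<d. \<forall>j<d. i \<noteq> 0 \<or> j \<noteq> 0 \<longrightarrow> \<sigma> i \<noteq> 0 \<or> \<tau> j \<noteq> 0" by blast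
    note c = gadget_corner[OF inj' lt ne]
    have "x = rdang u g"
    proof (rule Rgt_edge[OF xy(1)])
      show "Rgt u g 0 \<in> x" using xy(3) \<sigma>[OF d01(1)] c(1) by simp
      fix j assume j: "j < d" "0 < j"
      obtain i where "0 < i" "i < d" "\<tau> i = j" using c(4)[OF j] by blast
      then show "x \<noteq> {Lft u g j, Rgt u g 0}"
        using xy(5)[of i] \<sigma>[OF d01(1)] c(1) \<tau>[of i] by (simp add: insert_commute)
    qed
    moreover have "y = ldang u g"
    proof (rule Lft_edge[OF xy(2)])
      show "Lft u g 0 \<in> y" using xy(4) \<tau>[OF d01(1)] c(2) by simp
      fix j assume j: "j < d" "0 < j"
      obtain i where "0 < i" "i < d" "\<sigma> i = j" using c(3)[OF j] by blast
      then show "y \<noteq> {Lft u g 0, Rgt u g j}"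
        using xy(6)[of i] \<tau>[OF d01(1)] c(2) \<sigma>[of i] by (simp add: insert_commute)
    qed
    moreover have "u \<in> units S" using pq(1)[of 1 1] Rgt d01 by auto
    ultimately show ?thesis using that by (simp add: insert_commute)
  qed
qed

lemma clique3_ring:
  assumes "clique3 (radj S) x y z"
  obtains v a b c where "x = {v, a}" "y = {v, b}" "z = {v, c}" "distinct [a, b, c]"
    "vadj v a" "vadj v b" "vadj v c" "valid d S v" "valid d S a" "valid d S b" "valid d S c"
proof -
  have xyz: "radj S x y" "radj S y z" "radj S x z" using assms by (auto simp: clique3_def)
  then obtain v where v: "v \<in> x" "v \<in> y" by (auto simp: edge_adj_def)
  have vz: "v \<in> z" using ring.triangle_common[OF xyz v] .
  have E: "x \<in> edges (ring_graph d S)" "y \<in> edges (ring_graph d S)" "z \<in> edges (ring_graph d S)"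
    using xyz by (auto simp: edge_adj_def)
  obtain a where a: "x = {v, a}" "valid d S v" "valid d S a" "vadj v a"
    using ring_edge_other[OF E(1) v(1)] .
  obtain b where b: "y = {v, b}" "valid d S b" "vadj v b"
    using ring_edge_other[OF E(2) v(2)] .
  obtain c where c: "z = {v, c}" "valid d S c" "vadj v c"
    using ring_edge_other[OF E(3) vz] .
  have "distinct [a, b, c]" using xyz a b c by (auto simp: edge_adj_def)
  then show ?thesis using that a b c by blast
qed

text \<open>Two distinct linked edges are the dangling edges of one gadget; as they also meet, the
  gadget is a loop, and \<open>s\<close> is the one skeleton edge at its port.\<close>

lemma anchor0_ring:
  assumes "anchor0 d (radj S) s"
  obtains u w p where "u \<in> units S" "s = {Sk u w, Sk u p}" "(w, p) \<in> {(W0, V0), (W1, U1), (W2, U1)}"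
proof -
  obtain l l' where l: "linked d (radj S) l l'" and cl: "clique3 (radj S) l l' s"
    using assms by (auto simp: anchor0_def)
  obtain v a b c where v: "l = {v, a}" "l' = {v, b}" "s = {v, c}" "distinct [a, b, c]" "vadj v c"
    using clique3_ring[OF cl] .
  then have "l \<noteq> l'" by (auto simp: doubleton_eq_iff)
  then obtain u g where ug: "u \<in> units S" "{l, l'} = {ldang u g, rdang u g}"
    using linked_ring[OF l] by metis
  have "v \<in> ldang u g \<inter> rdang u g" using ug(2) v(1,2) by (auto simp: doubleton_eq_iff)
  then have vg: "v = Sk u (lport g)" "g \<noteq> GC"
    by (cases g; auto simp: ldang_def rdang_def runit_def)+
  have "{a, b} = {Lft u g 0, Rgt u g 0}"
    using ug(2) v(1,2) vg by (cases g) (auto simp: doubleton_eq_iff ldang_def rdang_def runit_def)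
  then show ?thesis
    using that[OF ug(1)] v(3,4,5) vg
    by (cases g) (auto simp: vadj_nbrs doubleton_eq_iff)
qed

lemma other_two:
  assumes "\<And>z. vadj v z \<Longrightarrow> valid d S z \<Longrightarrow> z = c \<or> z = P \<or> z = Q"
    "vadj v a" "vadj v b" "valid d S a" "valid d S b" "distinct [a, b, c]"
  shows "{{v, a}, {v, b}} = {{v, P}, {v, Q}}"
proof -
  have "(a = P \<and> b = Q) \<or> (a = Q \<and> b = P)"
    using assms(1)[of a] assms(1)[of b] assms(2-) by auto
  then show ?thesis by (auto simp: insert_commute)
qed

text \<open>Both ends of \<open>s\<close> have degree 3, so \<open>x\<close> and \<open>y\<close>
  are the two remaining edges at one of them.\<close>

lemma triple_anchor0:
  assumes "clique3 (radj S) x y s" "s = {Sk u w, Sk u p}" "(w, p) \<in> {(W0, V0), (W1, U1), (W2, U1)}"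
  shows "(\<exists>g. g \<noteq> GC \<and> {x, y} = {ldang u g, rdang u g}) \<or>
    (\<exists>v \<in> units S. u = nxt v \<and> {x, y} = {rdang v GC, hub_edge u}) \<or>
    {x, y} = {twig1 u, stem u} \<or> {x, y} = {twig2 u, stem u}"
proof -
  obtain v a b c where v: "x = {v, a}" "y = {v, b}" "s = {v, c}" and
    ab: "vadj v a" "vadj v b" "valid d S a" "valid d S b" "distinct [a, b, c]"
    using clique3_ring[OF assms(1)] .
  have xy: "{x, y} = {{v, P}, {v, Q}}"
    if "\<And>z. vadj v z \<Longrightarrow> valid d S z \<Longrightarrow> z = c \<or> z = P \<or> z = Q" for P Q
    unfolding v using that ab by (rule other_two)
  have "(v = Sk u w \<and> c = Sk u p) \<or> (v = Sk u p \<and> c = Sk u w)"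
    using v(3) assms(2) by (auto simp: doubleton_eq_iff)
  then consider "v = Sk u W0" "c = Sk u V0" | "v = Sk u W1" "c = Sk u U1" | "v = Sk u W2" "c = Sk u U1"
    | "v = Sk u V0" "c = Sk u W0" | "v = Sk u U1" "c = Sk u W1" | "v = Sk u U1" "c = Sk u W2"
    using assms(3) by blast
  then show ?thesis
  proof cases
    case 1
    have "{x, y} = {{v, Lft u G0 0}, {v, Rgt u G0 0}}"
      by (rule xy) (use 1 in \<open>auto simp: vadj_nbrs\<close>)
    then have "{x, y} = {ldang u G0, rdang u G0}"
      using 1 by (simp add: ldang_def rdang_def runit_def insert_commute)
    then show ?thesis by (intro disjI1 exI[of _ G0]) simp
  next
    case 2
    have "{x, y} = {{v, Lft u G1 0}, {v, Rgt u G1 0}}"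
      by (rule xy) (use 2 in \<open>auto simp: vadj_nbrs\<close>)
    then have "{x, y} = {ldang u G1, rdang u G1}"
      using 2 by (simp add: ldang_def rdang_def runit_def insert_commute)
    then show ?thesis by (intro disjI1 exI[of _ G1]) simp
  next
    case 3
    have "{x, y} = {{v, Lft u G2 0}, {v, Rgt u G2 0}}"
      by (rule xy) (use 3 in \<open>auto simp: vadj_nbrs\<close>)
    then have "{x, y} = {ldang u G2, rdang u G2}"
      using 3 by (simp add: ldang_def rdang_def runit_def insert_commute)
    then show ?thesis by (intro disjI1 exI[of _ G2]) simp
  next
    case 4
    \<comment> \<open>This finds the unit \<open>z\<close> before \<open>u\<close>: \<open>a\<close>
      and \<open>b\<close> differ from \<open>W0\<close> and cannot both be \<open>V1\<close>, so
      one of them is the end of a \<open>GC\<close>.\<close>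
    have "a \<noteq> b" "a \<noteq> c" "b \<noteq> c" using ab(5) by auto
    then have "(\<exists>z. u = nxt z \<and> a = Rgt z GC 0) \<or> (\<exists>z. u = nxt z \<and> b = Rgt z GC 0)"
      using ab(1,2) unfolding 4 vadj_nbrs by blast
    then obtain e z where z: "u = nxt z" "e \<in> {a, b}" "e = Rgt z GC 0" by blast
    then have zu: "z \<in> units S" using ab(3,4) by auto
    have "t = c \<or> t = Rgt z GC 0 \<or> t = Sk u V1" if "vadj v t" "valid d S t" for t
      using that 4 z(1) zu nxt_inj[of _ S z] by (auto simp: vadj_nbrs)
    then have "{x, y} = {{v, Rgt z GC 0}, {v, Sk u V1}}" by (rule xy)
    then have "{x, y} = {rdang z GC, hub_edge u}"
      using 4 z(1) by (simp add: rdang_def hub_edge_def runit_def insert_commute)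
    then show ?thesis using z(1) zu by blast
  next
    case 5
    have "{x, y} = {{v, Sk u W2}, {v, Sk u V1}}"
      by (rule xy) (use 5 in \<open>auto simp: vadj_nbrs\<close>)
    then have "{x, y} = {twig2 u, stem u}"
      using 5 by (simp add: twig2_def stem_def)
    then show ?thesis by blast
  next
    case 6
    have "{x, y} = {{v, Sk u W1}, {v, Sk u V1}}"
      by (rule xy) (use 6 in \<open>auto simp: vadj_nbrs\<close>)
    then have "{x, y} = {twig1 u, stem u}"
      using 6 by (simp add: twig1_def stem_def)
    then show ?thesis by blast
  qed
qed

text \<open>Among the edges listed in \<open>anchor0_ring\<close> only the two twigs of a unit meet,
  and they do so at \<open>U1\<close>, whose third edge is the stem.\<close>

lemma anchor1_ring:
  assumes "anchor1 d (radj S) t"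
  obtains u where "u \<in> units S" "t = stem u"
proof -
  obtain s s' where s: "anchor0 d (radj S) s" "anchor0 d (radj S) s'" and cl: "clique3 (radj S) s s' t"
    using assms by (auto simp: anchor1_def)
  obtain u w p where u: "u \<in> units S" "s = {Sk u w, Sk u p}" "(w, p) \<in> {(W0, V0), (W1, U1), (W2, U1)}"
    using anchor0_ring[OF s(1)] .
  obtain u' w' p' where u': "u' \<in> units S" "s' = {Sk u' w', Sk u' p'}"
    "(w', p') \<in> {(W0, V0), (W1, U1), (W2, U1)}"
    using anchor0_ring[OF s(2)] .
  obtain v a b c where v: "s = {v, a}" "s' = {v, b}" "t = {v, c}" "distinct [a, b, c]" "vadj v c"
    using clique3_ring[OF cl] .
  have "s \<inter> s' \<noteq> {}" "s \<noteq> s'" using v by (auto simp: doubleton_eq_iff)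
  then have uu: "u' = u" "p = U1" "p' = U1" "w \<noteq> w'"
    using u(2,3) u'(2,3) by auto
  then have "v = Sk u U1"
    using v(1,2) u(2,3) u'(2,3) by (auto simp: doubleton_eq_iff)
  moreover have "{a, b} = {Sk u W1, Sk u W2}"
    using v(1,2) u(2,3) u'(2,3) uu calculation by (auto simp: doubleton_eq_iff)
  ultimately have "t = stem u" using v(3,4,5) by (auto simp: vadj_nbrs stem_def doubleton_eq_iff)
  then show ?thesis using that u(1) by blast
qed

lemma triple_anchor1:
  assumes "clique3 (radj S) x y (stem u)"
  shows "{x, y} = {twig1 u, twig2 u} \<or> {x, y} = {hub_edge u, ldang u GC}"
proof -
  obtain v a b c where v: "x = {v, a}" "y = {v, b}" "stem u = {v, c}" and
    ab: "vadj v a" "vadj v b" "valid d S a" "valid d S b" "distinct [a, b, c]"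
    using clique3_ring[OF assms(1)] .
  have xy: "{x, y} = {{v, P}, {v, Q}}"
    if "\<And>z. vadj v z \<Longrightarrow> valid d S z \<Longrightarrow> z = c \<or> z = P \<or> z = Q" for P Q
    unfolding v using that ab by (rule other_two)
  consider "v = Sk u V1" "c = Sk u U1" | "v = Sk u U1" "c = Sk u V1"
    using v(3) by (auto simp: stem_def doubleton_eq_iff)
  then show ?thesis
  proof cases
    case 1
    have "{x, y} = {{v, Sk u V0}, {v, Lft u GC 0}}"
      by (rule xy) (use 1 in \<open>auto simp: vadj_nbrs\<close>)
    then have "{x, y} = {hub_edge u, ldang u GC}"
      using 1 by (simp add: hub_edge_def ldang_def insert_commute)
    then show ?thesis by blast
  next
    case 2
    have "{x, y} = {{v, Sk u W1}, {v, Sk u W2}}"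
      by (rule xy) (use 2 in \<open>auto simp: vadj_nbrs\<close>)
    then have "{x, y} = {twig1 u, twig2 u}"
      using 2 by (simp add: twig1_def twig2_def)
    then show ?thesis by blast
  qed
qed

text \<open>The edge \<open>b\<close> lies in both triples. Comparing the possibilities leaves
  \<open>b = hub_edge u\<close>, a genuine move in which the gadget \<open>GC\<close> is crossed or
  collapsed, or \<open>b\<close> a twig; then \<open>a\<close> is a stem, which is linked only to
  itself.\<close>

lemma step_ring:
  assumes "step d (radj S) x x'"
  shows "(\<exists>v \<in> units S. x \<in> {ldang v GC, rdang v GC} \<and> x' = ldang (nxt v) GC) \<or>
    (\<exists>u. x = stem u \<and> x' \<in> {twig1 u, twig2 u})"
proof -
  obtain a b s t where st: "linked d (radj S) x a" "anchor0 d (radj S) s" "clique3 (radj S) a b s"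
    "anchor1 d (radj S) t" "clique3 (radj S) b x' t"
    using assms by (auto simp: step_def)
  obtain u w p where u: "s = {Sk u w, Sk u p}" "(w, p) \<in> {(W0, V0), (W1, U1), (W2, U1)}"
    using anchor0_ring[OF st(2)] .
  obtain u' where u': "t = stem u'" using anchor1_ring[OF st(4)] .
  have T0: "(\<exists>g. g \<noteq> GC \<and> {a, b} = {ldang u g, rdang u g}) \<or>
    (\<exists>v \<in> units S. u = nxt v \<and> {a, b} = {rdang v GC, hub_edge u}) \<or>
    {a, b} = {twig1 u, stem u} \<or> {a, b} = {twig2 u, stem u}"
    using triple_anchor0[OF st(3) u] .
  have "{b, x'} = {twig1 u', twig2 u'} \<or> {b, x'} = {hub_edge u', ldang u' GC}"
    using triple_anchor1 st(5) u' by simp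
  then have T1: "(b = twig1 u' \<and> x' = twig2 u') \<or> (b = twig2 u' \<and> x' = twig1 u') \<or>
      (b = hub_edge u' \<and> x' = ldang u' GC) \<or> (b = ldang u' GC \<and> x' = hub_edge u')"
    unfolding doubleton_eq_iff by blast
  have lk: "x = a \<or> (\<exists>v \<in> units S. \<exists>g. (x = ldang v g \<and> a = rdang v g) \<or> (x = rdang v g \<and> a = ldang v g))"
    using linked_ring[OF st(1)] unfolding doubleton_eq_iff by metis
  note dist = edge_names_distinct edge_names_distinct[symmetric] edge_names_inject
  consider g where "g \<noteq> GC" "b = ldang u g \<or> b = rdang u g"
    | v where "v \<in> units S" "u = nxt v" "(a = rdang v GC \<and> b = hub_edge u) \<or> b = rdang v GC"
    | "b = stem u" | "a = stem u" "b = twig1 u \<or> b = twig2 u"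
    using T0 unfolding doubleton_eq_iff by blast
  then show ?thesis
  proof cases
    case 1
    then show ?thesis using T1 by (elim disjE) (simp_all add: dist)
  next
    case 2
    then have a: "a = rdang v GC" "x' = ldang u GC"
      using T1 by (elim disjE; simp add: dist)+
    have "x \<in> {ldang v GC, rdang v GC}"
      using lk unfolding a by (auto simp: dist)
    then show ?thesis using 2 a by blast
  next
    case 3
    then show ?thesis using T1 by (elim disjE) (simp_all add: dist)
  next
    case 4
    then have "x = stem u" using lk by (auto simp: dist)
    moreover have "x' = twig1 u \<or> x' = twig2 u"
      using T1 4(2) by (elim disjE) (simp_all add: dist)
    ultimately show ?thesis by blast
  qed
qed

text \<open>The spurious steps from a stem end in a twig, where no further step starts.\<close>

lemma step_step_ring:
  assumes "step d (radj S) x x'" "step d (radj S) x' x''"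
  shows "\<exists>v \<in> units S. x' = ldang v GC \<and> x'' = ldang (nxt v) GC"
  using step_ring[OF assms(1)] step_ring[OF assms(2)]
  by (auto simp: edge_names_distinct edge_names_distinct[symmetric] edge_names_inject)
section \<open>Homomorphisms between rings\<close>

lemma radj_star:
  assumes "vadj v x" "vadj v y" "x \<noteq> y" "valid d S v" "valid d S x" "valid d S y"
  shows "radj S {v, x} {v, y}"
  using assms by (auto simp: edge_adj_def ring_edge_iff doubleton_eq_iff)

lemma linked_dang:
  assumes "u \<in> units S"
  shows "linked d (radj S) (ldang u g) (rdang u g)"
  unfolding linked_def
proof (intro exI conjI allI impI)
  let ?M = "\<lambda>i j. {Lft u g i, Rgt u g j}"
  have units: "u \<in> units S" "runit g u \<in> units S" using assms runit_units by auto
  fix i j k assume ijk: "i < d" "j < d" "k < d" "j \<noteq> k"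
  define F where "F j = (if i = 0 \<and> j = 0 then Sk u (lport g) else Rgt u g j)" for j
  have "corner ?M (ldang u g) i j = {Lft u g i, F j}" for j
    by (simp add: corner_def F_def ldang_def)
  then show "radj S (corner ?M (ldang u g) i j) (corner ?M (ldang u g) i k)"
    using ijk units by (auto intro!: radj_star simp: F_def)
next
  let ?M = "\<lambda>i j. {Lft u g i, Rgt u g j}"
  have units: "u \<in> units S" "runit g u \<in> units S" using assms runit_units by auto
  fix i j k assume ijk: "i < d" "j < d" "k < d" "j \<noteq> k"
  define F where "F j = (if i = 0 \<and> j = 0 then Sk (runit g u) (rport g) else Lft u g j)" for j
  have "corner ?M (rdang u g) j i = {Rgt u g i, F j}" for j
    by (simp add: corner_def F_def rdang_def insert_commute)
  then show "radj S (corner ?M (rdang u g) j i) (corner ?M (rdang u g) k i)"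
    using ijk units by (auto intro!: radj_star simp: F_def)
qed

lemma clique3_star:
  assumes "vadj v x" "vadj v y" "vadj v z" "distinct [x, y, z]"
    "valid d S v" "valid d S x" "valid d S y" "valid d S z"
  shows "clique3 (radj S) {v, x} {v, y} {v, z}"
  using assms by (auto simp: clique3_def intro!: radj_star)

lemma anchor0_edges:
  assumes "u \<in> units S"
  shows "anchor0 d (radj S) {Sk u W0, Sk u V0}"
    "anchor0 d (radj S) (twig1 u)" "anchor0 d (radj S) (twig2 u)"
proof -
  have d0: "0 < d" using d3 by simp
  have "clique3 (radj S) (ldang u G0) (rdang u G0) {Sk u W0, Sk u V0}"
    using clique3_star[of "Sk u W0" "Lft u G0 0" "Rgt u G0 0" "Sk u V0" S] assms d0
    by (simp add: sk_nbrs runit_def ldang_def rdang_def insert_commute)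
  then show "anchor0 d (radj S) {Sk u W0, Sk u V0}"
    using linked_dang[OF assms] unfolding anchor0_def by blast
  have "clique3 (radj S) (ldang u G1) (rdang u G1) (twig1 u)"
    using clique3_star[of "Sk u W1" "Lft u G1 0" "Rgt u G1 0" "Sk u U1" S] assms d0
    by (simp add: sk_nbrs runit_def ldang_def rdang_def twig1_def insert_commute)
  then show "anchor0 d (radj S) (twig1 u)"
    using linked_dang[OF assms] unfolding anchor0_def by blast
  have "clique3 (radj S) (ldang u G2) (rdang u G2) (twig2 u)"
    using clique3_star[of "Sk u W2" "Lft u G2 0" "Rgt u G2 0" "Sk u U1" S] assms d0
    by (simp add: sk_nbrs runit_def ldang_def rdang_def twig2_def insert_commute)
  then show "anchor0 d (radj S) (twig2 u)"
    using linked_dang[OF assms] unfolding anchor0_def by blast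
qed

lemma anchor1_stem:
  assumes "u \<in> units S" shows "anchor1 d (radj S) (stem u)"
proof -
  have "clique3 (radj S) (twig1 u) (twig2 u) (stem u)"
    unfolding twig1_def twig2_def stem_def
    by (rule clique3_star) (use assms in \<open>auto simp: sk_nbrs runit_def\<close>)
  then show ?thesis using anchor0_edges[OF assms] unfolding anchor1_def by blast
qed

lemma step_ldang:
  assumes "u \<in> units S"
  shows "step d (radj S) (ldang u GC) (ldang (nxt u) GC)"
proof -
  let ?v = "nxt u"
  have v: "?v \<in> units S" using nxt_units[OF assms] .
  have "clique3 (radj S) {Sk ?v V0, Rgt u GC 0} {Sk ?v V0, Sk ?v V1} {Sk ?v V0, Sk ?v W0}"
    by (rule clique3_star) (use assms v d3 in \<open>auto simp: sk_nbrs runit_def\<close>)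
  then have 0: "clique3 (radj S) (rdang u GC) (hub_edge ?v) {Sk ?v W0, Sk ?v V0}"
    by (simp add: rdang_def hub_edge_def runit_def insert_commute)
  have "clique3 (radj S) {Sk ?v V1, Sk ?v V0} {Sk ?v V1, Lft ?v GC 0} {Sk ?v V1, Sk ?v U1}"
    by (rule clique3_star) (use v d3 in \<open>auto simp: sk_nbrs runit_def\<close>)
  then have 1: "clique3 (radj S) (hub_edge ?v) (ldang ?v GC) (stem ?v)"
    by (simp add: ldang_def hub_edge_def stem_def insert_commute)
  show ?thesis
    unfolding step_def
    using linked_dang[OF assms] anchor0_edges(1)[OF v] 0 anchor1_stem[OF v] 1 by blast
qed

lemma funpow_nxt: "i < m \<Longrightarrow> (nxt ^^ j) (m, i) = (m, (i + j) mod m)"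
  by (induction j) (auto simp: mod_Suc_eq)

text \<open>A walk once round the ring of length \<open>m\<close> closes up after \<open>m\<close>
  steps. Its image moves by \<open>nxt\<close> in a ring of some length \<open>m'\<close>, so
  closing up forces \<open>m' dvd m\<close>.\<close>

lemma hom_imp_dvd:
  assumes hom: "line_graph (ring_graph d S) \<lesssim>\<^sub>h line_graph (ring_graph d S')"
    and m: "m \<in> S" "m > 0"
  obtains m' where "m' \<in> S'" "m' dvd m"
proof -
  obtain f where f: "\<And>e e'. radj S e e' \<Longrightarrow> radj S' (f e) (f e')"
    using hom unfolding line_graph_hom_iff by blast
  define y where "y j = f (ldang ((nxt ^^ j) (m, 0)) GC)" for j
  have "(nxt ^^ j) (m, 0) \<in> units S" for j
    using m by (simp add: funpow_nxt units_def)
  then have "step d (radj S') (y j) (y (Suc j))" for j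
    unfolding y_def using step_hom[of "radj S" "radj S'" f d] f step_ldang by simp
  \<comment> \<open>Two consecutive steps locate the middle and the last edge but not the first, so
    \<open>v j\<close> belongs to \<open>y (Suc j)\<close> and the period is read off from
    \<open>y 1\<close> and \<open>y (Suc m)\<close>.\<close>
  then have "\<exists>v \<in> units S'. y (Suc j) = ldang v GC \<and> y (Suc (Suc j)) = ldang (nxt v) GC" for j
    using step_step_ring by blast
  then obtain v where v: "\<And>j. v j \<in> units S' \<and> y (Suc j) = ldang (v j) GC \<and>
      y (Suc (Suc j)) = ldang (nxt (v j)) GC" by metis
  have "v (Suc j) = nxt (v j)" for j
    using v[of j] v[of "Suc j"] edge_names_inject(5) by metis
  then have vj: "v j = (nxt ^^ j) (v 0)" for j by (induction j) auto
  have "y (Suc m) = y 1" using m by (simp add: y_def funpow_nxt)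
  then have "v m = v 0" using v[of m] v[of 0] by (simp add: edge_names_inject)
  obtain m' i where mi: "v 0 = (m', i)" by fastforce
  then have "m' \<in> S'" "i < m'" using v[of 0] by (auto simp: units_def)
  have "(i + m) mod m' = i mod m'"
    using \<open>v m = v 0\<close> vj[of m] mi funpow_nxt[OF \<open>i < m'\<close>, of m] \<open>i < m'\<close> by simp
  then have "m' dvd m"
    using mod_eq_dvd_iff_nat[of i "i + m" m'] by simp
  then show ?thesis using that \<open>m' \<in> S'\<close> by blast
qed
end

section \<open>Covering maps between rings\<close>

fun lift :: "(nat \<times> nat \<Rightarrow> nat \<times> nat) \<Rightarrow> vertex \<Rightarrow> vertex" where
  "lift h (Sk u p) = Sk (h u) p"
| "lift h (Lft u g i) = Lft (h u) g i"
| "lift h (Rgt u g j) = Rgt (h u) g j"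

lemma slot_lift: "slot (lift h x) (lift h y) = slot x y"
  by (cases x; cases y) auto

text \<open>The ring of length \<open>m\<close> is wrapped round one whose length divides
  \<open>m\<close>. The vertex map need not be injective, but it preserves slots, so distinct edges
  at a vertex have distinct images.\<close>

lemma dvd_imp_hom:
  assumes "\<And>m. m \<in> S \<Longrightarrow> \<exists>m' \<in> S'. m' > 0 \<and> m' dvd m"
  shows "line_graph (ring_graph d S) \<lesssim>\<^sub>h line_graph (ring_graph d S')"
proof -
  obtain r where r: "\<And>m. m \<in> S \<Longrightarrow> r m \<in> S' \<and> r m > 0 \<and> r m dvd m"
    using assms by metis
  define h where "h = (\<lambda>(m, i). (r m, i mod r m))"
  have h_units: "h u \<in> units S'" if "u \<in> units S" for u
    using that r by (auto simp: h_def units_def)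
  \<comment> \<open>\<open>r m dvd m\<close> makes the return from \<open>m - 1\<close> to 0
    compatible with reduction modulo \<open>r m\<close>.\<close>
  have h_nxt: "h (nxt u) = nxt (h u)" if "u \<in> units S" for u
    using that r by (auto simp: h_def units_def mod_mod_cancel mod_Suc_eq)
  have h_runit: "h (runit g u) = runit g (h u)" if "u \<in> units S" for u g
    using h_nxt[OF that] by (simp add: runit_def)
  have valid: "valid d S' (lift h x)" if "valid d S x" for x
    using that h_units by (cases x) auto
  have adj: "vadj (lift h x) (lift h y)" if "vadj x y" "valid d S x" "valid d S y" for x y
    using that h_runit by (cases x; cases y) auto
  have edge: "lift h ` e \<in> edges (ring_graph d S')" if e: "e \<in> edges (ring_graph d S)" for e
  proof -
    obtain x y where "e = {x, y}" "valid d S x" "valid d S y" "vadj x y"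
      using ring_edge_ends[OF e] .
    then show ?thesis using valid adj by (simp add: ring_edge_iff)
  qed
  have "edge_adj (edges (ring_graph d S')) (lift h ` e) (lift h ` e')"
    if ee: "edge_adj (edges (ring_graph d S)) e e'" for e e'
  proof -
    have E: "e \<in> edges (ring_graph d S)" "e' \<in> edges (ring_graph d S)"
      using ee by (auto simp: edge_adj_def)
    obtain v where v: "v \<in> e" "v \<in> e'" using ee by (auto simp: edge_adj_def)
    obtain x where x: "e = {v, x}" "valid d S v" "valid d S x" "vadj v x"
      using ring_edge_other[OF E(1) v(1)] .
    obtain y where y: "e' = {v, y}" "valid d S y" "vadj v y"
      using ring_edge_other[OF E(2) v(2)] .
    have "x \<noteq> y" using ee x y by (auto simp: edge_adj_def)
    then have "slot v x \<noteq> slot v y" using slot_inj x y by blast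
    then have "lift h x \<noteq> lift h y" using slot_lift[of h v x] slot_lift[of h v y] by auto
    then show ?thesis
      using edge[OF E(1)] edge[OF E(2)] x(1) y(1) by (auto simp: edge_adj_def doubleton_eq_iff)
  qed
  then show ?thesis
    unfolding line_graph_hom_iff using edge by blast
qed

section \<open>The interval from \<open>K\<^sub>d\<close> to \<open>K\<^bsub>d+1\<^esub>\<close>\<close>

definition sk_colour :: "part \<Rightarrow> part \<Rightarrow> nat" where
  "sk_colour p q = (if {p, q} \<in> {{V0, W0}, {U1, W1}} then 1
     else if {p, q} = {V1, U1} then 3 else 2)"

text \<open>A proper edge colouring with colours 0 to \<open>d\<close>. The Latin square
  \<open>(i + j) mod d\<close> leaves 0 free at both ends of the missing edge; the left dangling
  edge takes 0, but the right one needs the extra colour \<open>d\<close>, as both meet at the port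
  of a loop. For \<open>d = 3\<close> the edge from \<open>V1\<close> to \<open>U1\<close> also has
  colour \<open>d\<close>, but meets no right dangling edge.\<close>

fun colour :: "nat \<Rightarrow> vertex \<Rightarrow> vertex \<Rightarrow> nat" where
  "colour d (Lft _ _ i) (Rgt _ _ j) = (i + j) mod d"
| "colour d (Rgt _ _ j) (Lft _ _ i) = (i + j) mod d"
| "colour d (Rgt _ _ _) (Sk _ _) = d"
| "colour d (Sk _ _) (Rgt _ _ _) = d"
| "colour d (Sk _ p) (Sk _ q) = sk_colour p q"
| "colour d _ _ = 0"

lemma colour_sym: "colour d x y = colour d y x"
  by (cases x; cases y) (auto simp: sk_colour_def insert_commute)

lemma colour_less:
  assumes "d \<ge> 3" shows "colour d x y < d + 1"
  using assms by (cases x; cases y) (auto simp: sk_colour_def intro: less_SucI)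

lemma mod_add_eq_cancel:
  fixes d :: nat
  assumes "(i + j) mod d = (i + k) mod d" "j < d" "k < d" shows "j = k"
proof -
  have *: "b = a" if "a \<le> b" "b < d" "(i + a) mod d = (i + b) mod d" for a b
  proof -
    have "d dvd b - a"
      using mod_eq_dvd_iff_nat[of "i + a" "i + b" d] that by simp
    moreover have "b - a < d" using that(2) by linarith
    ultimately have "b - a = 0" using nat_dvd_not_less[of "b - a" d] by blast
    then show ?thesis using that(1) by linarith
  qed
  show ?thesis
  proof (cases "j \<le> k")
    case True
    then show ?thesis using *[OF _ assms(3,1)] by simp
  next
    case False
    then show ?thesis using *[OF _ assms(2) assms(1)[symmetric]] by simp
  qed
qed

lemma colour_proper:
  assumes "d \<ge> 3" "valid d S y" "valid d S z" "vadj x y" "vadj x z" "y \<noteq> z"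
  shows "colour d x y \<noteq> colour d x z"
proof (cases x)
  case (Sk u p)
  have uniq: "v = w" if "u = nxt v" "u = nxt w" "v \<in> units S" "w \<in> units S" for v w
    by (rule nxt_inj[OF that(3,4)]) (use that(1,2) in simp)
  have d: "d \<noteq> 0" "d \<noteq> 1" "d \<noteq> 2" "1 \<noteq> d" "2 \<noteq> d" using assms(1) by auto
  show ?thesis
  proof (cases p)
    case V0
    then show ?thesis
      using assms uniq unfolding Sk V0 vadj_nbrs
      by (elim disjE exE) (auto simp: sk_colour_def doubleton_eq_iff d)
  qed (use assms in \<open>auto simp: Sk vadj_nbrs sk_colour_def doubleton_eq_iff d\<close>)
next
  case (Lft u g i)
  have cancel: "(i + j) mod d \<noteq> (i + k) mod d" if "j < d" "k < d" "j \<noteq> k" for j k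
    using mod_add_eq_cancel[of i j d k] that by auto
  show ?thesis using Lft assms by (cases y; cases z) (simp_all add: cancel)
next
  case (Rgt u g i)
  have cancel: "(j + i) mod d \<noteq> (k + i) mod d" if "j < d" "k < d" "j \<noteq> k" for j k
    using mod_add_eq_cancel[of i j d k] that by (auto simp: add.commute)
  have ne: "n mod d \<noteq> d" "d \<noteq> n mod d" for n
    using assms(1) mod_less_divisor[of d n] by linarith+
  show ?thesis using Rgt assms by (cases y; cases z) (simp_all add: cancel ne)
qed

definition edge_colour :: "nat \<Rightarrow> vertex set \<Rightarrow> nat" where
  "edge_colour d e = (SOME c. \<exists>x y. e = {x, y} \<and> c = colour d x y)"

lemma edge_colour_eq: "edge_colour d {x, y} = colour d x y"
proof -
  have "\<exists>x' y'. {x, y} = {x', y'} \<and> edge_colour d {x, y} = colour d x' y'"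
    unfolding edge_colour_def by (rule someI_ex) blast
  then show ?thesis using colour_sym by (metis doubleton_eq_iff)
qed

lemma ring_to_complete:
  assumes "d \<ge> 3"
  shows "line_graph (ring_graph d S) \<lesssim>\<^sub>h complete_graph (d + 1)"
  unfolding hom_to_def graph_hom_def
proof (intro exI conjI allI impI)
  show "edge_colour d ` verts (line_graph (ring_graph d S)) \<subseteq> verts (complete_graph (d + 1))"
    using colour_less[OF assms]
    by (auto simp: verts_line_graph complete_graph_def edge_colour_eq elim!: ring_edge_ends)
  fix e e' assume "{e, e'} \<in> edges (line_graph (ring_graph d S))"
  then have ee: "edge_adj (edges (ring_graph d S)) e e'" by (simp add: edges_line_graph_iff)
  have E: "e \<in> edges (ring_graph d S)" "e' \<in> edges (ring_graph d S)"
    using ee by (auto simp: edge_adj_def)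
  obtain v where v: "v \<in> e" "v \<in> e'" using ee by (auto simp: edge_adj_def)
  obtain x where x: "e = {v, x}" "valid d S x" "vadj v x"
    using ring_edge_other[OF E(1) v(1)] .
  obtain y where y: "e' = {v, y}" "valid d S y" "vadj v y"
    using ring_edge_other[OF E(2) v(2)] .
  have "x \<noteq> y" using ee x y by (auto simp: edge_adj_def)
  then show "{edge_colour d e, edge_colour d e'} \<in> edges (complete_graph (d + 1))"
    using colour_proper[OF assms x(2) y(2) x(3) y(3)] colour_less[OF assms]
    by (simp add: edges_complete_graph_iff x(1) y(1) edge_colour_eq)
qed

lemma complete_to_ring:
  assumes "d \<ge> 3" "m \<in> S" "m > 0"
  shows "complete_graph d \<lesssim>\<^sub>h line_graph (ring_graph d S)"
  unfolding hom_to_def graph_hom_def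
proof (intro exI conjI allI impI)
  \<comment> \<open>The star at index 1: unlike at index 0, all of its \<open>d\<close> edges run
    inside the gadget.\<close>
  let ?F = "\<lambda>j. {Lft (m, 0) GC 1, Rgt (m, 0) GC j}"
  have u: "(m, 0) \<in> units S" using assms by (simp add: units_def)
  have E: "?F j \<in> edges (ring_graph d S)" if "j < d" for j
    using that u assms(1) by (simp add: ring_edge_iff)
  then show "?F ` verts (complete_graph d) \<subseteq> verts (line_graph (ring_graph d S))"
    by (auto simp: verts_line_graph complete_graph_def)
  fix j k assume "{j, k} \<in> edges (complete_graph d)"
  then have "j < d" "k < d" "j \<noteq> k" by (auto simp: edges_complete_graph_iff)
  then show "{?F j, ?F k} \<in> edges (line_graph (ring_graph d S))"
    unfolding edges_line_graph_iff using E by (auto simp: edge_adj_def doubleton_eq_iff)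
qed

lemma not_complete_to_ring:
  assumes "d \<ge> 3"
  shows "\<not> complete_graph (d + 1) \<lesssim>\<^sub>h line_graph (ring_graph d S)"
proof
  interpret triangle_free_graph "edges (ring_graph d S)" d using triangle_free_ring[OF assms] .
  assume "complete_graph (d + 1) \<lesssim>\<^sub>h line_graph (ring_graph d S)"
  then obtain f where "\<And>u v. {u, v} \<in> edges (complete_graph (d + 1)) \<Longrightarrow>
      {f u, f v} \<in> edges (line_graph (ring_graph d S))"
    by (auto simp: hom_to_def graph_hom_def)
  then show False
    using no_large_clique[of f] by (simp add: edges_complete_graph_iff edges_line_graph_iff)
qed

section \<open>Coding countable partial orders by divisibility\<close>

text \<open>Enumerate \<open>Q\<close> and assign to \<open>z\<close> a prime \<open>p\<^sub>z\<close>. With \<open>N x\<close> the product of the \<open>p\<^sub>z\<close> over all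
  \<open>z\<close> above \<open>x\<close> that are enumerated no later than \<open>x\<close>, the set assigned to \<open>x\<close> consists of all \<open>N z\<close>
  for \<open>z\<close> below \<open>x\<close> enumerated no later than \<open>x\<close>.\<close>

lemma poset_divisibility_coding:
  fixes Q :: "'q set" and leQ :: "'q rel"
  assumes "countable Q" and refl: "\<forall>x \<in> Q. (x, x) \<in> leQ" and "trans leQ"
  obtains A :: "'q \<Rightarrow> nat set" where
    "\<forall>x \<in> Q. finite (A x) \<and> A x \<noteq> {} \<and> (\<forall>a \<in> A x. a > 0)"
    "\<forall>x \<in> Q. \<forall>y \<in> Q. (x, y) \<in> leQ \<longleftrightarrow> (\<forall>a \<in> A x. \<exists>b \<in> A y. b dvd a)"
proof -
  define idx where "idx = to_nat_on Q"
  have idx: "inj_on idx Q" unfolding idx_def by (rule inj_on_to_nat_on[OF assms(1)])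
  define pr where "pr x = from_nat_into {p :: nat. prime p} (idx x)" for x
  have inf: "infinite {p :: nat. prime p}" using primes_infinite by simp
  have pr: "prime (pr x)" for x
    using from_nat_into[of "{p :: nat. prime p}" "idx x"] inf by (auto simp: pr_def)
  have pr_inj: "x = y" if "x \<in> Q" "y \<in> Q" "pr x = pr y" for x y
    using that inf idx by (simp add: pr_def inj_on_eq_iff)
  define up where "up x = {z \<in> Q. (x, z) \<in> leQ \<and> idx z \<le> idx x}" for x
  define down where "down x = {z \<in> Q. (z, x) \<in> leQ \<and> idx z \<le> idx x}" for x
  define N where "N x = (\<Prod>z \<in> up x. pr z)" for x
  \<comment> \<open>The bound on \<open>idx\<close> keeps \<open>up x\<close> and
    \<open>down x\<close> finite even if infinitely many elements of \<open>Q\<close> lie above or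
    below \<open>x\<close>.\<close>
  have fin: "finite {z \<in> Q. P z \<and> idx z \<le> n}" for P n
    by (rule inj_on_finite[of idx _ "{..n}"]) (use idx in \<open>auto intro: inj_on_subset\<close>)
  have fin_up: "finite (up x)" and fin_down: "finite (down x)" for x
    using fin unfolding up_def down_def by auto
  have Npos: "N x > 0" for x
    unfolding N_def by (rule prod_pos) (simp add: pr prime_gt_0_nat)
  have N_dvd: "N y dvd N x \<longleftrightarrow> y \<in> up x" if "x \<in> Q" "y \<in> Q" for x y
  proof
    assume "y \<in> up x"
    then have "up y \<subseteq> up x" using \<open>trans leQ\<close> by (auto simp: up_def dest: transD)
    then show "N y dvd N x" using fin_up by (auto simp: N_def intro: prod_dvd_prod_subset)
  next
    assume "N y dvd N x"
    moreover have "y \<in> up y" using that refl by (simp add: up_def)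
    then have "pr y dvd N y" unfolding N_def using fin_up by (intro dvd_prodI) auto
    ultimately have "pr y dvd N x" using dvd_trans by blast
    then obtain z where z: "z \<in> up x" "pr y dvd pr z"
      using pr fin_up unfolding N_def by (auto simp: prime_dvd_prod_iff)
    then have "pr y = pr z" using pr primes_dvd_imp_eq by blast
    then have "y = z" using pr_inj[of y z] that z by (auto simp: up_def)
    then show "y \<in> up x" using z by simp
  qed
  show ?thesis
  proof (rule that[of "\<lambda>x. N ` down x"])
    show "\<forall>x \<in> Q. finite (N ` down x) \<and> N ` down x \<noteq> {} \<and> (\<forall>a \<in> N ` down x. a > 0)"
      using fin_down Npos refl by (auto simp: down_def)
  next
    show "\<forall>x \<in> Q. \<forall>y \<in> Q. (x, y) \<in> leQ \<longleftrightarrow> (\<forall>a \<in> N ` down x. \<exists>b \<in> N ` down y. b dvd a)"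
    proof (intro ballI)
      fix x y assume xy: "x \<in> Q" "y \<in> Q"
      show "(x, y) \<in> leQ \<longleftrightarrow> (\<forall>a \<in> N ` down x. \<exists>b \<in> N ` down y. b dvd a)"
      proof
        assume le: "(x, y) \<in> leQ"
        have "\<exists>w \<in> down y. N w dvd N z" if z: "z \<in> down x" for z
        proof -
          have zQ: "z \<in> Q" and zy: "(z, y) \<in> leQ"
            using z le \<open>trans leQ\<close> by (auto simp: down_def dest: transD)
          show ?thesis
          \<comment> \<open>If \<open>z\<close> is enumerated no later than \<open>y\<close>, it is
            itself in \<open>down y\<close>; otherwise \<open>y\<close> is in \<open>up z\<close>,
            so \<open>N y\<close> divides \<open>N z\<close>.\<close>
          proof (cases "idx z \<le> idx y")
            case True
            then have "z \<in> down y" using zQ zy by (simp add: down_def)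
            then show ?thesis by (intro bexI[of _ z]) auto
          next
            case False
            then have "y \<in> up z" using xy zy by (simp add: up_def)
            then have "N y dvd N z" using N_dvd zQ xy by blast
            moreover have "y \<in> down y" using xy refl by (simp add: down_def)
            ultimately show ?thesis by blast
          qed
        qed
        then show "\<forall>a \<in> N ` down x. \<exists>b \<in> N ` down y. b dvd a" by blast
      next
        assume "\<forall>a \<in> N ` down x. \<exists>b \<in> N ` down y. b dvd a"
        \<comment> \<open>The single element \<open>N x\<close> suffices: its divisor
          \<open>N w\<close> comes from some \<open>w\<close> below \<open>y\<close> that lies above
          \<open>x\<close>.\<close>
        moreover have "x \<in> down x" using xy refl by (simp add: down_def)
        ultimately obtain w where w: "w \<in> down y" "N w dvd N x" by blast
        then have "w \<in> up x" using N_dvd xy by (auto simp: down_def)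
        then show "(x, y) \<in> leQ"
          using w(1) \<open>trans leQ\<close> by (auto simp: up_def down_def dest: transD)
      qed
    qed
  qed
qed

section \<open>Representation of \<open>Q\<close> by line graphs of unions of rings\<close>

theorem theorem3:
  fixes d :: nat and Q :: "'q set" and leQ :: "'q rel"
  assumes "d \<ge> 3"
    and "countable Q"
    and "partial_order_on Q leQ"
  shows "\<exists>\<phi> :: 'q \<Rightarrow> nat graph.
    (\<forall>x \<in> Q. finite_graph (\<phi> x) \<and>
        complete_graph d \<lesssim>\<^sub>h line_graph (\<phi> x) \<and>
        line_graph (\<phi> x) \<lesssim>\<^sub>h complete_graph (d + 1) \<and>
        \<not> complete_graph (d + 1) \<lesssim>\<^sub>h line_graph (\<phi> x)) \<and>
    (\<forall>x \<in> Q. \<forall>y \<in> Q. (x, y) \<in> leQ \<longleftrightarrow> line_graph (\<phi> x) \<lesssim>\<^sub>h line_graph (\<phi> y))"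
proof -
  have refl: "\<forall>x \<in> Q. (x, x) \<in> leQ" and "trans leQ"
    using assms(3) by (auto simp: partial_order_on_def preorder_on_def dest: refl_onD)
  obtain A where
    A: "\<forall>x \<in> Q. finite (A x) \<and> A x \<noteq> {} \<and> (\<forall>a \<in> A x. a > (0 :: nat))" and
    A_le: "\<forall>x \<in> Q. \<forall>y \<in> Q. (x, y) \<in> leQ \<longleftrightarrow> (\<forall>a \<in> A x. \<exists>b \<in> A y. b dvd a)"
    using poset_divisibility_coding[OF assms(2) refl \<open>trans leQ\<close>] .
  define R where "R x = ring_graph d (A x)" for x
  define \<phi> where "\<phi> x = map_graph (to_nat :: vertex \<Rightarrow> nat) (R x)" for x
  have fwd: "line_graph (R x) \<lesssim>\<^sub>h line_graph (\<phi> x)" and bwd: "line_graph (\<phi> x) \<lesssim>\<^sub>h line_graph (R x)" for x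
    unfolding \<phi>_def by (simp_all add: line_graph_to_map_graph map_graph_to_line_graph)
  show ?thesis
  proof (intro exI[of _ \<phi>] conjI ballI)
    fix x assume x: "x \<in> Q"
    then obtain m where m: "m \<in> A x" "m > 0" using A by blast
    show "finite_graph (\<phi> x)"
      unfolding \<phi>_def R_def using bspec[OF A x] by (intro finite_map_graph finite_ring_graph) auto
    show "complete_graph d \<lesssim>\<^sub>h line_graph (\<phi> x)"
      using complete_to_ring[OF assms(1) m] fwd[of x] unfolding R_def by (rule hom_to_trans)
    show "line_graph (\<phi> x) \<lesssim>\<^sub>h complete_graph (d + 1)"
      using bwd[of x] ring_to_complete[OF assms(1)] unfolding R_def by (rule hom_to_trans)
    show "\<not> complete_graph (d + 1) \<lesssim>\<^sub>h line_graph (\<phi> x)"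
    proof
      assume "complete_graph (d + 1) \<lesssim>\<^sub>h line_graph (\<phi> x)"
      from hom_to_trans[OF this bwd] show False
        using not_complete_to_ring[OF assms(1)] by (simp add: R_def)
    qed
    fix y assume y: "y \<in> Q"
    have "line_graph (\<phi> x) \<lesssim>\<^sub>h line_graph (\<phi> y) \<longleftrightarrow> line_graph (R x) \<lesssim>\<^sub>h line_graph (R y)"
      by (meson hom_to_trans[OF hom_to_trans[OF fwd _] bwd] hom_to_trans[OF hom_to_trans[OF bwd _] fwd])
    also have "\<dots> \<longleftrightarrow> (\<forall>a \<in> A x. \<exists>b \<in> A y. b dvd a)"
    proof
      assume hom: "line_graph (R x) \<lesssim>\<^sub>h line_graph (R y)"
      show "\<forall>a \<in> A x. \<exists>b \<in> A y. b dvd a"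
      proof
        fix a assume a: "a \<in> A x"
        then have "a > 0" using A x by blast
        then obtain b where "b \<in> A y" "b dvd a"
          using hom_imp_dvd[OF assms(1) hom[unfolded R_def] a] by blast
        then show "\<exists>b \<in> A y. b dvd a" by blast
      qed
    next
      assume "\<forall>a \<in> A x. \<exists>b \<in> A y. b dvd a"
      then show "line_graph (R x) \<lesssim>\<^sub>h line_graph (R y)"
        unfolding R_def using A y by (intro dvd_imp_hom) blast
    qed
    finally show "(x, y) \<in> leQ \<longleftrightarrow> line_graph (\<phi> x) \<lesssim>\<^sub>h line_graph (\<phi> y)"
      using A_le x y by simp
  qed
qed

end
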